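(* Let $X$ be a compact, locally contractible subspace of $\mathbb{R}^n$, and let $\vec f=(f_1,f_2,\ldots,f_k):X\to\mathbb{R}^k$ be a continuous function. Then, for any $q\in\mathbb{Z}$, the rank invariant $\rho_{(X,\vec f),q}$ takes only finite values: for any $\vec u=(u_1,\ldots,u_k)$ and $\vec v=(v_1,\ldots,v_k)$ in $\mathbb{R}^k$ with $u_j<v_j$ for $j=1,2,\ldots,k$, $$\rho_{(X,\vec f),q}(\vec u,\vec v):=\operatorname{rank}\,\operatorname{im}\,H_q\big(X_{\vec f\le\vec u}\hookrightarrow X_{\vec f\le\vec v}\big)<+\infty,$$ where the map is the inclusion, $X_{\vec f\le\vec u}=\{x\in X: f_j(x)\le u_j,\ j=1,2,\ldots,k\}$ and $X_{\vec f\le\vec v}=\{x\in X: f_j(x)\le v_j,\ j=1,2,\ldots,k\}$.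
   Context: Subspaces of $\mathbb{R}^n$ carry the subspace topology. A space $Y$ is locally contractible if for every point $y\in Y$ and every neighborhood $U$ of $y$ in $Y$ there is a neighborhood $V\subseteq U$ of $y$ such that the inclusion $V\hookrightarrow U$ is homotopic to a constant map. $H_q$ denotes the $q$-th singular homology functor with coefficients in a fixed ring, either $\mathbb{Z}$ or a field (with $H_q=0$ for $q<0$). For a continuous map $g:A\to B$, $H_q(g):H_q(A)\to H_q(B)$ is the induced homomorphism and $\operatorname{im}H_q(g)$ is its image; $\operatorname{rank}$ denotes the rank of an abelian group when the coefficients are $\mathbb{Z}$, and the vector space dimension when the coefficients are a field. *)

theory Defs
  imports
    "HOL-Analysis.Analysis"
    "HOL-Homology.Homology"
    "HOL-Library.Extended_Nat"
    "Jordan_Normal_Form.Missing_VectorSpace"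
begin

section \<open>Locally contractible spaces\<close>

text \<open>Neighbourhoods need not be open.\<close>

definition neighbourhood_in :: "'a topology \<Rightarrow> 'a \<Rightarrow> 'a set \<Rightarrow> bool" where
  "neighbourhood_in Y y U \<longleftrightarrow>
     U \<subseteq> topspace Y \<and> (\<exists>W. openin Y W \<and> y \<in> W \<and> W \<subseteq> U)"

text \<open>This is weaker than \<open>locally contractible\<close> in the sense of \<^const>\<open>locally\<close>: the set \<open>V\<close> only
  has to be contractible inside \<open>U\<close>.\<close>

definition locally_contractible_space :: "'a topology \<Rightarrow> bool" where
  "locally_contractible_space Y \<longleftrightarrow>
     (\<forall>y \<in> topspace Y. \<forall>U. neighbourhood_in Y y U \<longrightarrow>
        (\<exists>V. neighbourhood_in Y y V \<and> V \<subseteq> U \<and>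
           (\<exists>a. homotopic_with (\<lambda>_. True) (subtopology Y V) (subtopology Y U) id (\<lambda>_. a))))"


section \<open>Singular homology with coefficients in a commutative ring\<close>

text \<open>The library provides singular homology with integer coefficients only. The definitions below
  follow it with \<^typ>\<open>int\<close> replaced by the coefficient type, and record the scalar multiplication.
  They reuse the library's singular simplices.\<close>

type_synonym ('a, 'c) coeff_chain = "((nat \<Rightarrow> real) \<Rightarrow> 'a) \<Rightarrow>\<^sub>0 'c"

definition scale_chain :: "'c::comm_ring_1 \<Rightarrow> ('b \<Rightarrow>\<^sub>0 'c) \<Rightarrow> ('b \<Rightarrow>\<^sub>0 'c)" where
  "scale_chain a c = Poly_Mapping.map ((*) a) c"

definition linear_extend ::
    "('b \<Rightarrow> ('d \<Rightarrow>\<^sub>0 'c::comm_ring_1)) \<Rightarrow> ('b \<Rightarrow>\<^sub>0 'c) \<Rightarrow> ('d \<Rightarrow>\<^sub>0 'c)" where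
  "linear_extend b c = (\<Sum>s\<in>Poly_Mapping.keys c. scale_chain (Poly_Mapping.lookup c s) (b s))"

definition coeff_boundary ::
    "nat \<Rightarrow> ('a, 'c::comm_ring_1) coeff_chain \<Rightarrow> ('a, 'c) coeff_chain" where
  "coeff_boundary p c =
     (if p = 0 then 0
      else linear_extend
             (\<lambda>s. \<Sum>k\<le>p. Poly_Mapping.single (singular_face p k s) ((- 1) ^ k)) c)"

definition coeff_chain_map ::
    "nat \<Rightarrow> ('a \<Rightarrow> 'b) \<Rightarrow> ('a, 'c::comm_ring_1) coeff_chain \<Rightarrow> ('b, 'c) coeff_chain" where
  "coeff_chain_map p g c = linear_extend (\<lambda>s. Poly_Mapping.single (simplex_map p g s) 1) c"

definition coeff_chains :: "int \<Rightarrow> 'a topology \<Rightarrow> ('a, 'c::comm_ring_1) coeff_chain set" where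
  "coeff_chains q X =
     (if q < 0 then {0} else {c. Poly_Mapping.keys c \<subseteq> singular_simplex_set (nat q) X})"

definition coeff_cycles :: "int \<Rightarrow> 'a topology \<Rightarrow> ('a, 'c::comm_ring_1) coeff_chain set" where
  "coeff_cycles q X = {c \<in> coeff_chains q X. coeff_boundary (nat q) c = 0}"

definition coeff_boundaries :: "int \<Rightarrow> 'a topology \<Rightarrow> ('a, 'c::comm_ring_1) coeff_chain set" where
  "coeff_boundaries q X = coeff_boundary (nat (q + 1)) ` coeff_chains (q + 1) X"

text \<open>The fields \<^const>\<open>monoid.mult\<close> and \<^const>\<open>one\<close> of a module record play no role.\<close>

definition cycle_module ::
    "int \<Rightarrow> 'a topology \<Rightarrow> ('c::comm_ring_1, ('a, 'c) coeff_chain) module" where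
  "cycle_module q X =
     \<lparr>carrier = coeff_cycles q X, monoid.mult = undefined, one = undefined,
      zero = 0, add = (+), smult = scale_chain\<rparr>"

definition quotient_module ::
    "('c, 'b, 'm) module_scheme \<Rightarrow> 'b set \<Rightarrow> ('c, 'b set) module" where
  "quotient_module M N =
     \<lparr>carrier = a_rcosets\<^bsub>M\<^esub> N, monoid.mult = undefined, one = undefined,
      zero = N, add = set_add M, smult = (\<lambda>a S. \<Union>x\<in>S. N +>\<^bsub>M\<^esub> (a \<odot>\<^bsub>M\<^esub> x))\<rparr>"

definition homology_module ::
    "int \<Rightarrow> 'a topology \<Rightarrow> ('c::comm_ring_1, ('a, 'c) coeff_chain set) module" where
  "homology_module q X = quotient_module (cycle_module q X) (coeff_boundaries q X)"

definition module_hom_induced ::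
    "int \<Rightarrow> 'b topology \<Rightarrow> ('a \<Rightarrow> 'b) \<Rightarrow>
     ('a, 'c::comm_ring_1) coeff_chain set \<Rightarrow> ('b, 'c) coeff_chain set" where
  "module_hom_induced q Y g S =
     (\<Union>c\<in>S. coeff_boundaries q Y +>\<^bsub>cycle_module q Y\<^esub> coeff_chain_map (nat q) g c)"


section \<open>Rank and dimension\<close>

definition independent_in_group :: "('a, 'm) monoid_scheme \<Rightarrow> 'a set \<Rightarrow> bool" where
  "independent_in_group G S \<longleftrightarrow>
     finite S \<and> S \<subseteq> carrier G \<and>
     (\<forall>c :: 'a \<Rightarrow> int.
        finprod G (\<lambda>x. x [^]\<^bsub>G\<^esub> c x) S = \<one>\<^bsub>G\<^esub> \<longrightarrow> (\<forall>x\<in>S. c x = 0))"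

definition abelian_group_rank :: "('a, 'm) monoid_scheme \<Rightarrow> enat" where
  "abelian_group_rank G = (SUP S \<in> {S. independent_in_group G S}. enat (card S))"

text \<open>\<^const>\<open>vectorspace.dim\<close> is a natural number, meaningful for finite-dimensional spaces only.\<close>

definition vectorspace_dimension ::
    "('c, 'm) ring_scheme \<Rightarrow> ('c, 'b, 'l) module_scheme \<Rightarrow> enat" where
  "vectorspace_dimension K V =
     (if vectorspace.fin_dim K V then enat (vectorspace.dim K V) else \<infinity>)"


section \<open>The rank invariant\<close>

definition sublevel_set ::
    "(real^'n) set \<Rightarrow> (real^'n \<Rightarrow> real^'k) \<Rightarrow> real^'k \<Rightarrow> (real^'n) set" where
  "sublevel_set X f u = {x \<in> X. \<forall>j. f x $ j \<le> u $ j}"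

definition rank_invariant_int ::
    "(real^'n) set \<Rightarrow> (real^'n \<Rightarrow> real^'k) \<Rightarrow> int \<Rightarrow> real^'k \<Rightarrow> real^'k \<Rightarrow> enat" where
  "rank_invariant_int X f q u v =
     (let A = top_of_set (sublevel_set X f u); B = top_of_set (sublevel_set X f v)
      in abelian_group_rank
           ((homology_group q B)
              \<lparr>carrier := hom_induced q A {} B {} id ` carrier (homology_group q A)\<rparr>))"

definition type_ring :: "'c::comm_ring_1 ring" where
  "type_ring = \<lparr>carrier = UNIV, monoid.mult = (*), one = 1, zero = 0, add = (+)\<rparr>"

definition rank_invariant_field ::
    "'c::field itself \<Rightarrow>
     (real^'n) set \<Rightarrow> (real^'n \<Rightarrow> real^'k) \<Rightarrow> int \<Rightarrow> real^'k \<Rightarrow> real^'k \<Rightarrow> enat" where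
  "rank_invariant_field _ X f q u v =
     (let A = top_of_set (sublevel_set X f u); B = top_of_set (sublevel_set X f v);
          H = (homology_module q B :: ('c, (real^'n, 'c) coeff_chain set) module)
      in vectorspace_dimension (type_ring :: 'c ring)
           (H\<lparr>carrier := module_hom_induced q B id ` carrier (homology_module q A)\<rparr>))"

end

(* The inclusion of one sublevel set into the other factors through an open set N of X, and every
   compact K inside an open N has an open neighbourhood W inside N for which the map
   H_q W -> H_q N has finite rank. This is proved by induction on q. Cover K by finitely many small
   compact pieces, each having a neighbourhood contractible in N, and adjoin the pieces one at a
   time. For two compact sets K1 and K2 with neighbourhoods N1 and N2 of finite rank in N, the
   induction hypothesis yields a neighbourhood W12 of the intersection of K1 and K2 with
   H_(q-1) W12 -> H_(q-1) (N1 Int N2) of finite rank. Shrinking N1 and N2 to W1 and W2 with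
   W1 Int W2 inside W12, the Mayer-Vietoris argument shows that H_q (W1 Un W2) -> H_q N has finite
   rank. Rank is measured by linear relations between cycles modulo boundaries, which serves
   the integers and fields simultaneously. *)

theory Submission
  imports Defs
begin

text \<open>The homology of a sublevel set may itself have infinite rank, since sublevel sets need
  not be locally contractible. The strict inequalities between u and v leave room for the open set
  where every component of f is below v, and each shrinking of a neighbourhood uses some of that
  room. The induction must range over all pairs of a compact K and an open N around it: two sets
  contractible in N can have an intersection about which nothing is known, so only the same
  statement one degree lower can control it. The pieces are compact because disjoint compact sets
  can be separated, which confines the overlap of their neighbourhoods; the neighbourhoods are open
  because subdivision needs an open cover. Images of inclusions do not form an exact sequence, so
  the Mayer-Vietoris argument runs on chains. A rank bound is a number N such that any N cycles
  satisfy a nontrivial relation; such bounds multiply along successive obstructions. Over the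
  integers this ignores torsion.\<close>

section \<open>Scalar multiples and linear extensions of finitely supported functions\<close>

lemma lookup_scale_chain [simp]: "Poly_Mapping.lookup (scale_chain a c) s = a * Poly_Mapping.lookup c s"
  by (simp add: scale_chain_def Poly_Mapping.map.rep_eq when_def)

lemma scale_chain_zero [simp]: "scale_chain a 0 = 0" "scale_chain 0 c = 0"
  by (auto intro!: poly_mapping_eqI)

lemma scale_chain_one [simp]: "scale_chain 1 c = c"
  by (auto intro!: poly_mapping_eqI)

lemma scale_chain_scale_chain [simp]: "scale_chain a (scale_chain b c) = scale_chain (a * b) c"
  by (auto intro!: poly_mapping_eqI)

lemma scale_chain_minus_one: "scale_chain (- 1) c = - c"
  by (auto intro!: poly_mapping_eqI)

lemma scale_chain_add: "scale_chain a (c + d) = scale_chain a c + scale_chain a d"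
  by (auto intro!: poly_mapping_eqI simp: lookup_add algebra_simps)

lemma scale_chain_diff: "scale_chain a (c - d) = scale_chain a c - scale_chain a d"
  by (rule poly_mapping_eqI) (simp add: lookup_minus right_diff_distrib)

lemma scale_chain_add_left: "scale_chain (a + b) c = scale_chain a c + scale_chain b c"
  by (auto intro!: poly_mapping_eqI simp: lookup_add algebra_simps)

lemma scale_chain_minus_left: "scale_chain (- a) c = - scale_chain a c"
  by (auto intro!: poly_mapping_eqI)

lemma scale_chain_sum: "scale_chain a (\<Sum>i\<in>I. c i) = (\<Sum>i\<in>I. scale_chain a (c i))"
  by (induction I rule: infinite_finite_induct) (auto simp: scale_chain_add)

lemma scale_chain_single [simp]: "scale_chain a (Poly_Mapping.single s b) = Poly_Mapping.single s (a * b)"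
  by (auto intro!: poly_mapping_eqI simp: lookup_single when_def)

lemma keys_scale_chain_subset: "Poly_Mapping.keys (scale_chain a c) \<subseteq> Poly_Mapping.keys c"
  by (auto simp: in_keys_iff)

text \<open>Cancellation can make the support of a sum smaller than the union of the supports.
  Summing over a common larger set reduces linearity to termwise identities.\<close>

lemma linear_extend_superset:
  assumes "finite S" "Poly_Mapping.keys c \<subseteq> S"
  shows "linear_extend b c = (\<Sum>s\<in>S. scale_chain (Poly_Mapping.lookup c s) (b s))"
  unfolding linear_extend_def using assms
  by (intro sum.mono_neutral_left) (auto simp: in_keys_iff)

lemma linear_extend_zero [simp]: "linear_extend b 0 = 0"
  by (simp add: linear_extend_def)

lemma linear_extend_add: "linear_extend b (c + d) = linear_extend b c + linear_extend b d"
proof -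
  let ?S = "Poly_Mapping.keys c \<union> Poly_Mapping.keys d"
  have "Poly_Mapping.keys (c + d) \<subseteq> ?S"
    by (rule keys_add)
  then show ?thesis
    by (simp add: linear_extend_superset [where S = ?S] lookup_add scale_chain_add_left sum.distrib)
qed

lemma linear_extend_scale: "linear_extend b (scale_chain a c) = scale_chain a (linear_extend b c)"
  using linear_extend_superset [OF finite_keys keys_scale_chain_subset, of b a c]
  by (simp add: linear_extend_def scale_chain_sum)

lemma linear_extend_uminus: "linear_extend b (- c) = - linear_extend b c"
  by (metis linear_extend_scale scale_chain_minus_one)

lemma linear_extend_diff: "linear_extend b (c - d) = linear_extend b c - linear_extend b d"
  using linear_extend_add [of b c "- d"] by (simp add: linear_extend_uminus)

lemma linear_extend_sum: "linear_extend b (\<Sum>i\<in>I. c i) = (\<Sum>i\<in>I. linear_extend b (c i))"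
  by (induction I rule: infinite_finite_induct) (auto simp: linear_extend_add)

lemma linear_extend_single [simp]: "linear_extend b (Poly_Mapping.single s a) = scale_chain a (b s)"
  by (subst linear_extend_superset [where S = "{s}"]) auto

lemma linear_extend_cong:
  "(\<And>s. s \<in> Poly_Mapping.keys c \<Longrightarrow> b s = b' s) \<Longrightarrow> linear_extend b c = linear_extend b' c"
  by (simp add: linear_extend_def)

lemma linear_extend_linear_extend:
  "linear_extend b (linear_extend b' c) = linear_extend (\<lambda>s. linear_extend b (b' s)) c"
  by (simp add: linear_extend_def [of b'] linear_extend_def [of "\<lambda>s. linear_extend b (b' s)"]
      linear_extend_sum linear_extend_scale)

lemma linear_extend_ident [simp]: "linear_extend (\<lambda>s. Poly_Mapping.single s 1) c = c"
proof (rule poly_mapping_eqI)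
  show "Poly_Mapping.lookup (linear_extend (\<lambda>s. Poly_Mapping.single s 1) c) k = Poly_Mapping.lookup c k" for k
    by (cases "k \<in> Poly_Mapping.keys c")
      (auto simp: linear_extend_def lookup_sum lookup_single when_def in_keys_iff if_distrib cong: if_cong)
qed

lemma linear_extend_add_fun: "linear_extend (\<lambda>s. b s + b' s) c = linear_extend b c + linear_extend b' c"
  by (simp add: linear_extend_def scale_chain_add sum.distrib)

lemma linear_extend_diff_fun: "linear_extend (\<lambda>s. b s - b' s) c = linear_extend b c - linear_extend b' c"
  by (simp add: linear_extend_def scale_chain_diff sum_subtractf)

lemma keys_linear_extend_subset:
  "Poly_Mapping.keys (linear_extend b c) \<subseteq> (\<Union>s\<in>Poly_Mapping.keys c. Poly_Mapping.keys (b s))"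
proof -
  have "Poly_Mapping.keys (linear_extend b c) \<subseteq>
        (\<Union>s\<in>Poly_Mapping.keys c. Poly_Mapping.keys (scale_chain (Poly_Mapping.lookup c s) (b s)))"
    unfolding linear_extend_def by (rule keys_sum)
  also have "\<dots> \<subseteq> (\<Union>s\<in>Poly_Mapping.keys c. Poly_Mapping.keys (b s))"
    using keys_scale_chain_subset by fast
  finally show ?thesis .
qed

lemma keys_linear_extend_subsetI:
  assumes "Poly_Mapping.keys c \<subseteq> S" "\<And>s. s \<in> S \<Longrightarrow> Poly_Mapping.keys (b s) \<subseteq> T"
  shows "Poly_Mapping.keys (linear_extend b c) \<subseteq> T"
  using assms keys_linear_extend_subset by fast

section \<open>Extension of coefficients\<close>

definition coeff_embed :: "('b \<Rightarrow>\<^sub>0 int) \<Rightarrow> ('b \<Rightarrow>\<^sub>0 'c::comm_ring_1)" where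
  "coeff_embed c = Poly_Mapping.map of_int c"

text \<open>Carries the library's operators on integer chains over to other coefficients.\<close>

definition coeff_ext :: "(('b \<Rightarrow>\<^sub>0 int) \<Rightarrow> ('d \<Rightarrow>\<^sub>0 int)) \<Rightarrow> ('b \<Rightarrow>\<^sub>0 'c) \<Rightarrow> ('d \<Rightarrow>\<^sub>0 'c::comm_ring_1)" where
  "coeff_ext \<phi> = linear_extend (\<lambda>s. coeff_embed (\<phi> (frag_of s)))"

lemma lookup_coeff_embed [simp]: "Poly_Mapping.lookup (coeff_embed c) s = of_int (Poly_Mapping.lookup c s)"
  by (simp add: coeff_embed_def Poly_Mapping.map.rep_eq when_def)

lemma coeff_embed_diff: "coeff_embed (c - d) = coeff_embed c - coeff_embed d"
  by (auto intro!: poly_mapping_eqI simp: lookup_minus)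

lemma coeff_embed_add: "coeff_embed (c + d) = coeff_embed c + coeff_embed d"
  by (auto intro!: poly_mapping_eqI simp: lookup_add)

lemma coeff_embed_0 [simp]: "coeff_embed 0 = 0"
  by (auto intro!: poly_mapping_eqI)

lemma coeff_embed_sum: "coeff_embed (\<Sum>i\<in>I. c i) = (\<Sum>i\<in>I. coeff_embed (c i))"
  by (induction I rule: infinite_finite_induct) (auto simp: coeff_embed_add)

lemma coeff_embed_single [simp]: "coeff_embed (Poly_Mapping.single s a) = Poly_Mapping.single s (of_int a)"
  by (auto intro!: poly_mapping_eqI simp: lookup_single when_def)

lemma coeff_embed_cmul [simp]: "coeff_embed (frag_cmul a c) = scale_chain (of_int a) (coeff_embed c)"
  by (auto intro!: poly_mapping_eqI)

lemma keys_coeff_embed_subset: "Poly_Mapping.keys (coeff_embed c) \<subseteq> Poly_Mapping.keys c"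
  by (auto simp: in_keys_iff)

text \<open>A map that respects differences is determined by its values on the generators, where
  both sides agree. Differences are the form in which the library states additivity of its chain
  operators.\<close>

lemma coeff_ext_embed:
  assumes diff: "\<And>c d. \<phi> (c - d) = \<phi> c - \<phi> d"
  shows "coeff_ext \<phi> (coeff_embed c) = coeff_embed (\<phi> c)"
proof -
  have zero: "\<phi> 0 = 0"
    using diff [of 0 0] by simp
  show ?thesis
    using subset_UNIV
    by (induction c rule: frag_induction)
      (auto simp: coeff_ext_def zero diff coeff_embed_diff linear_extend_diff)
qed

text \<open>This transports integer identities between composites. Only the outer operator has to be
  additive, because the inner one is evaluated on generators alone.\<close>

lemma coeff_ext_coeff_ext:
  assumes "\<And>c d. \<phi> (c - d) = \<phi> c - \<phi> d"
  shows "coeff_ext \<phi> (coeff_ext \<psi> c) = coeff_ext (\<lambda>c. \<phi> (\<psi> c)) c"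
  using assms
  by (simp add: coeff_ext_def [of \<psi>] coeff_ext_def [of "\<lambda>c. \<phi> (\<psi> c)"] linear_extend_linear_extend
      flip: coeff_ext_embed) (simp add: coeff_ext_def linear_extend_linear_extend)

lemma coeff_boundary_eq_coeff_ext: "coeff_boundary p c = coeff_ext (chain_boundary p) c"
proof (cases "p = 0")
  case True
  then show ?thesis
    by (simp add: coeff_boundary_def coeff_ext_def chain_boundary_def linear_extend_def)
next
  case False
  then show ?thesis
    by (simp add: coeff_boundary_def coeff_ext_def chain_boundary_of coeff_embed_sum)
qed

section \<open>Chains, cycles and boundaries\<close>

lemma coeff_chains_nat: "c \<in> coeff_chains (int p) X \<longleftrightarrow> Poly_Mapping.keys c \<subseteq> singular_simplex_set p X"
  by (simp add: coeff_chains_def)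

lemma coeff_chains_linear:
  shows "0 \<in> coeff_chains q X"
    and "c \<in> coeff_chains q X \<Longrightarrow> d \<in> coeff_chains q X \<Longrightarrow> c + d \<in> coeff_chains q X"
    and "c \<in> coeff_chains q X \<Longrightarrow> scale_chain a c \<in> coeff_chains q X"
  using keys_add [of c d] keys_scale_chain_subset [of a c]
  by (auto simp: coeff_chains_def split: if_splits)

lemma coeff_boundary_linear:
  "coeff_boundary p (c + d) = coeff_boundary p c + coeff_boundary p d"
  "coeff_boundary p (c - d) = coeff_boundary p c - coeff_boundary p d"
  "coeff_boundary p (scale_chain a c) = scale_chain a (coeff_boundary p c)"
  "coeff_boundary p 0 = 0"
  by (simp_all add: coeff_boundary_def linear_extend_add linear_extend_diff linear_extend_scale)

lemma coeff_chains_diff: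
  "c \<in> coeff_chains q X \<Longrightarrow> d \<in> coeff_chains q X \<Longrightarrow> c - d \<in> coeff_chains q X"
  using coeff_chains_linear(2) [of c q X "- d"] coeff_chains_linear(3) [of d q X "- 1"]
  by (simp add: scale_chain_minus_one)

lemma coeff_boundary_mem:
  fixes c :: "('a, 'c::comm_ring_1) coeff_chain"
  assumes "c \<in> coeff_chains (int (Suc p)) X"
  shows "coeff_boundary (Suc p) c \<in> coeff_chains (int p) X"
proof -
  have "Poly_Mapping.keys (\<Sum>k\<le>Suc p. Poly_Mapping.single (singular_face (Suc p) k s) ((- 1 :: 'c) ^ k))
        \<subseteq> singular_simplex_set p X"
    if "s \<in> singular_simplex_set (Suc p) X" for s
    using singular_simplex_singular_face [of "Suc p" X s] that
    by (intro order_trans [OF keys_sum]) (auto simp del: sum.atMost_Suc split: if_splits)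
  note sub = this
  show ?thesis
    unfolding coeff_chains_nat coeff_boundary_def if_not_P [OF nat.distinct(2)]
    by (rule keys_linear_extend_subsetI [OF assms [unfolded coeff_chains_nat] sub])
qed

lemma coeff_boundary_boundary:
  assumes "c \<in> coeff_chains (int (Suc p)) X"
  shows "coeff_boundary p (coeff_boundary (Suc p) c) = 0"
proof -
  have "coeff_ext (chain_boundary p) (coeff_ext (chain_boundary (Suc p)) c)
      = coeff_ext (\<lambda>c. chain_boundary p (chain_boundary (Suc p) c)) c"
    by (rule coeff_ext_coeff_ext) (rule chain_boundary_diff)
  also have "\<dots> = coeff_ext (\<lambda>c. 0) c"
    unfolding coeff_ext_def using assms unfolding coeff_chains_nat
    by (intro linear_extend_cong arg_cong [where f = coeff_embed] chain_boundary_boundary_alt [where X = X])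
      (auto simp: singular_chain_of)
  finally show ?thesis
    by (simp add: coeff_boundary_eq_coeff_ext coeff_ext_def linear_extend_def)
qed

lemma coeff_cycles_nat:
  "c \<in> coeff_cycles (int p) X \<longleftrightarrow> c \<in> coeff_chains (int p) X \<and> coeff_boundary p c = 0"
  by (simp add: coeff_cycles_def)

lemma coeff_boundaries_nat:
  "c \<in> coeff_boundaries (int p) X \<longleftrightarrow> (\<exists>d \<in> coeff_chains (int (Suc p)) X. c = coeff_boundary (Suc p) d)"
  by (auto simp: coeff_boundaries_def nat_add_distrib add.commute)

lemma coeff_cycles_linear:
  shows "0 \<in> coeff_cycles q X"
    and "c \<in> coeff_cycles q X \<Longrightarrow> d \<in> coeff_cycles q X \<Longrightarrow> c + d \<in> coeff_cycles q X"
    and "c \<in> coeff_cycles q X \<Longrightarrow> scale_chain a c \<in> coeff_cycles q X"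
  by (auto simp: coeff_cycles_def coeff_chains_linear coeff_boundary_linear)

lemma coeff_boundaries_linear:
  shows "0 \<in> coeff_boundaries q X"
    and "c \<in> coeff_boundaries q X \<Longrightarrow> d \<in> coeff_boundaries q X \<Longrightarrow> c + d \<in> coeff_boundaries q X"
    and "c \<in> coeff_boundaries q X \<Longrightarrow> scale_chain a c \<in> coeff_boundaries q X"
proof -
  show "0 \<in> coeff_boundaries q X"
    unfolding coeff_boundaries_def
    by (rule image_eqI [where x = 0]) (simp_all add: coeff_boundary_linear coeff_chains_linear)
  show "c + d \<in> coeff_boundaries q X" if "c \<in> coeff_boundaries q X" "d \<in> coeff_boundaries q X"
    using that unfolding coeff_boundaries_def
    by (auto simp: coeff_boundary_linear(1) [symmetric]
        intro: coeff_chains_linear)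
  show "scale_chain a c \<in> coeff_boundaries q X" if "c \<in> coeff_boundaries q X"
    using that unfolding coeff_boundaries_def
    by (auto simp: coeff_boundary_linear(3) [symmetric] intro: coeff_chains_linear)
qed

lemma coeff_boundaries_subset_cycles: "coeff_boundaries q X \<subseteq> coeff_cycles q X"
proof (cases "q < 0")
  case False
  then obtain p where "q = int p"
    by (metis nonneg_int_cases not_less)
  then show ?thesis
    using coeff_boundary_mem coeff_boundary_boundary by (auto simp: coeff_boundaries_nat coeff_cycles_nat)
next
  case True
  \<comment> \<open>For \<open>q = -1\<close> the chains of degree \<open>q + 1\<close> may be
    nonzero, but the boundary map of degree 0 is zero by definition.\<close>
  then have "nat (q + 1) = 0" by simp
  with True show ?thesis
    by (auto simp: coeff_boundaries_def coeff_boundary_def coeff_cycles_linear)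
qed

lemma singular_simplex_set_mono:
  "S \<subseteq> T \<Longrightarrow> singular_simplex_set p (subtopology X S) \<subseteq> singular_simplex_set p (subtopology X T)"
  using singular_simplex_mono by blast

lemma coeff_chains_mono: "S \<subseteq> T \<Longrightarrow> coeff_chains q (subtopology X S) \<subseteq> coeff_chains q (subtopology X T)"
  using singular_simplex_set_mono [of S T "nat q" X] by (auto simp: coeff_chains_def)

lemma coeff_cycles_mono: "S \<subseteq> T \<Longrightarrow> coeff_cycles q (subtopology X S) \<subseteq> coeff_cycles q (subtopology X T)"
  using coeff_chains_mono [of S T q X] by (auto simp: coeff_cycles_def)

lemma coeff_boundaries_mono:
  "S \<subseteq> T \<Longrightarrow> coeff_boundaries q (subtopology X S) \<subseteq> coeff_boundaries q (subtopology X T)"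
  using coeff_chains_mono [of S T "q + 1" X] by (auto simp: coeff_boundaries_def)

text \<open>Simplices lying in both sets are assigned to \<open>x\<close>. The restriction
  \<open>?r S\<close> is a linear extension, so the two restrictions add up to the extension of the
  identity.\<close>

lemma coeff_chains_split:
  assumes "Poly_Mapping.keys c \<subseteq> singular_simplex_set p X \<union> singular_simplex_set p Y"
  obtains x y where "x \<in> coeff_chains (int p) X" "y \<in> coeff_chains (int p) Y" "c = x + y"
proof
  let ?r = "\<lambda>S. linear_extend (\<lambda>s. if s \<in> S then Poly_Mapping.single s 1 else 0) c"
  let ?S = "singular_simplex_set p X"
  show "?r ?S \<in> coeff_chains (int p) X"
    unfolding coeff_chains_nat by (rule keys_linear_extend_subsetI [OF assms]) auto
  show "?r (- ?S) \<in> coeff_chains (int p) Y"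
    unfolding coeff_chains_nat by (rule keys_linear_extend_subsetI [OF assms]) auto
  show "c = ?r ?S + ?r (- ?S)"
    unfolding linear_extend_add_fun [symmetric]
    by (rule trans [OF linear_extend_ident [symmetric]], rule linear_extend_cong) auto
qed

section \<open>Subdivision of cycles\<close>

lemma coeff_ext_mem:
  assumes "c \<in> coeff_chains (int p) X"
    and "\<And>c. singular_chain p X c \<Longrightarrow> singular_chain r Y (\<phi> c)"
  shows "coeff_ext \<phi> c \<in> coeff_chains (int r) Y"
  unfolding coeff_chains_nat coeff_ext_def
proof (rule keys_linear_extend_subsetI)
  show "Poly_Mapping.keys c \<subseteq> singular_simplex_set p X"
    using assms by (simp add: coeff_chains_nat)
  fix s assume "s \<in> singular_simplex_set p X"
  then have "singular_chain r Y (\<phi> (frag_of s))"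
    by (intro assms) (simp add: singular_chain_of)
  then show "Poly_Mapping.keys (coeff_embed (\<phi> (frag_of s))) \<subseteq> singular_simplex_set r Y"
    using keys_coeff_embed_subset unfolding singular_chain_def by fast
qed

text \<open>Enough barycentric subdivisions put each simplex inside \<open>V1\<close> or
  \<open>V2\<close>. Iterated subdivision is chain homotopic to the identity, so on a cycle it
  changes only a boundary.\<close>

lemma coeff_cycle_subdivide:
  fixes X :: "'a topology"
  assumes V: "openin X V1" "openin X V2" "topspace X = V1 \<union> V2"
    and z: "z \<in> coeff_cycles (int p) X"
  obtains x y e where "x \<in> coeff_chains (int p) (subtopology X V1)"
    "y \<in> coeff_chains (int p) (subtopology X V2)"
    "e \<in> coeff_chains (int (Suc p)) X" "z = x + y + coeff_boundary (Suc p) e"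
proof -
  have ex: "\<exists>n. \<forall>m\<ge>n. \<forall>f \<in> Poly_Mapping.keys ((singular_subdivision p ^^ m) (frag_of s)). \<exists>W\<in>{V1, V2}. f \<in> standard_simplex p \<rightarrow> W"
    if "s \<in> Poly_Mapping.keys z" for s
  proof -
    have "singular_chain p X (frag_of s)"
      using that z by (auto simp: singular_chain_of coeff_cycles_nat coeff_chains_nat)
    from sufficient_iterated_singular_subdivision_exists [of "{V1, V2}" X, OF _ _ this] V
    show ?thesis
      by auto metis
  qed
  then obtain N where N: "\<And>s m f. \<lbrakk>s \<in> Poly_Mapping.keys z; m \<ge> N s;
      f \<in> Poly_Mapping.keys ((singular_subdivision p ^^ m) (frag_of s))\<rbrakk> \<Longrightarrow> \<exists>W\<in>{V1, V2}. f \<in> standard_simplex p \<rightarrow> W"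
    by metis
  \<comment> \<open>A number of subdivisions that serves all simplices of \<open>z\<close>. The sum
    bounds each \<open>N s\<close> and also makes sense when \<open>z\<close> has no
    simplices.\<close>
  define m where "m = (\<Sum>s\<in>Poly_Mapping.keys z. N s)"
  have m: "\<exists>W\<in>{V1, V2}. f \<in> standard_simplex p \<rightarrow> W"
    if "s \<in> Poly_Mapping.keys z" "f \<in> Poly_Mapping.keys ((singular_subdivision p ^^ m) (frag_of s))" for s f
    by (rule N [of s m]) (use that in \<open>auto simp: m_def intro: member_le_sum\<close>)
  obtain h :: "nat \<Rightarrow> 'a chain \<Rightarrow> 'a chain" where h: "\<And>p c1 c2. h p (c1-c2) = h p c1 - h p c2"
    "\<And>p X c. singular_chain p X c \<Longrightarrow> singular_chain (Suc p) X (h p c)"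
    "\<And>p X c. singular_chain p X c
       \<Longrightarrow> chain_boundary (Suc p) (h p c) + h (p - Suc 0) (chain_boundary p c)
                   = (singular_subdivision p ^^ m) c - c"
    using chain_homotopic_iterated_singular_subdivision [of m] by metis
  let ?Sd = "singular_subdivision p ^^ m :: 'a chain \<Rightarrow> 'a chain"
  let ?e = "coeff_ext (h p) z"
  have zc: "z \<in> coeff_chains (int p) X" and dz: "coeff_boundary p z = 0"
    using z by (auto simp: coeff_cycles_nat)
  have e: "?e \<in> coeff_chains (int (Suc p)) X"
    using zc h(2) by (rule coeff_ext_mem)
  \<comment> \<open>The integer chain homotopy identity is transferred generator by generator; its
    second summand vanishes afterwards because \<open>z\<close> is a cycle.\<close>
  have "coeff_boundary (Suc p) ?e + coeff_ext (h (p - Suc 0)) (coeff_boundary p z)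
      = coeff_ext (\<lambda>c. chain_boundary (Suc p) (h p c)) z + coeff_ext (\<lambda>c. h (p - Suc 0) (chain_boundary p c)) z"
    by (simp add: coeff_boundary_eq_coeff_ext coeff_ext_coeff_ext chain_boundary_diff h(1))
  also have "\<dots> = coeff_ext (\<lambda>c. ?Sd c - c) z"
    unfolding coeff_ext_def linear_extend_add_fun [symmetric]
    using zc by (intro linear_extend_cong)
       (auto simp: coeff_chains_nat h(3) singular_chain_of subset_iff simp flip: coeff_embed_add)
  also have "\<dots> = coeff_ext ?Sd z - z"
    by (simp add: coeff_ext_def coeff_embed_diff linear_extend_diff_fun)
  finally have eq: "coeff_boundary (Suc p) ?e = coeff_ext ?Sd z - z"
    by (simp add: dz coeff_ext_def)
  have Sd: "singular_chain p X (?Sd c)" if "singular_chain p X c" for c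
    by (induction m) (auto simp: that singular_chain_singular_subdivision)
  have "Poly_Mapping.keys (coeff_ext ?Sd z)
        \<subseteq> (\<Union>s\<in>Poly_Mapping.keys z. Poly_Mapping.keys (?Sd (frag_of s)))"
    unfolding coeff_ext_def
    by (rule order_trans [OF keys_linear_extend_subset]) (intro UN_mono order_refl keys_coeff_embed_subset)
  moreover have "Poly_Mapping.keys (coeff_ext ?Sd z) \<subseteq> singular_simplex_set p X"
    using coeff_ext_mem [OF zc Sd] by (simp add: coeff_chains_nat)
  ultimately have "Poly_Mapping.keys (coeff_ext ?Sd z) \<subseteq>
      singular_simplex_set p (subtopology X V1) \<union> singular_simplex_set p (subtopology X V2)"
  proof (intro subsetI)
    fix f assume f: "f \<in> Poly_Mapping.keys (coeff_ext ?Sd z)"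
    assume "Poly_Mapping.keys (coeff_ext ?Sd z) \<subseteq> (\<Union>s\<in>Poly_Mapping.keys z. Poly_Mapping.keys (?Sd (frag_of s)))"
      and *: "Poly_Mapping.keys (coeff_ext ?Sd z) \<subseteq> singular_simplex_set p X"
    with f obtain s where "s \<in> Poly_Mapping.keys z" "f \<in> Poly_Mapping.keys (?Sd (frag_of s))"
      by blast
    then have "f ` standard_simplex p \<subseteq> V1 \<or> f ` standard_simplex p \<subseteq> V2"
      using m by (simp add: image_subset_iff_funcset)
    moreover have "singular_simplex p X f"
      using * f by blast
    ultimately show "f \<in> singular_simplex_set p (subtopology X V1) \<union> singular_simplex_set p (subtopology X V2)"
      by (simp add: singular_simplex_subtopology)
  qed
  then obtain x y where xy: "x \<in> coeff_chains (int p) (subtopology X V1)"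
    "y \<in> coeff_chains (int p) (subtopology X V2)" "coeff_ext ?Sd z = x + y"
    by (rule coeff_chains_split)
  show thesis
  proof
    \<comment> \<open>The sign turns the boundary, which is the subdivided chain minus
      \<open>z\<close>, into the correction to be added to recover \<open>z\<close>.\<close>
    show "scale_chain (- 1) ?e \<in> coeff_chains (int (Suc p)) X"
      using e by (rule coeff_chains_linear)
    show "z = x + y + coeff_boundary (Suc p) (scale_chain (- 1) ?e)"
      using eq xy(3) unfolding coeff_boundary_linear(3) by (simp add: scale_chain_minus_one)
  qed (use xy in auto)
qed

section \<open>The cone operator of a contraction\<close>

text \<open>The contraction \<open>h\<close> is run at double speed, so that the cone is constant near its vertex, where
  the projection to the base is undefined.\<close>

definition cone_simplex ::
    "(real \<times> 'a \<Rightarrow> 'a) \<Rightarrow> 'a \<Rightarrow> nat \<Rightarrow> ((nat \<Rightarrow> real) \<Rightarrow> 'a) \<Rightarrow> (nat \<Rightarrow> real) \<Rightarrow> 'a" where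
  "cone_simplex h a p s =
     restrict (\<lambda>t. if t 0 \<le> 1/2 then h (2 * t 0, s (\<lambda>i. t (Suc i) / (1 - t 0))) else a)
       (standard_simplex (Suc p))"

definition cone_chain ::
    "(real \<times> 'a \<Rightarrow> 'a) \<Rightarrow> 'a \<Rightarrow> nat \<Rightarrow> ('a, 'c::comm_ring_1) coeff_chain \<Rightarrow> ('a, 'c) coeff_chain" where
  "cone_chain h a p = linear_extend (\<lambda>s. Poly_Mapping.single (cone_simplex h a p s) 1)"

text \<open>These are the barycentric coordinates of the projection from vertex 0 to the opposite
  face.\<close>

lemma standard_simplex_tail:
  assumes t: "t \<in> standard_simplex (Suc p)" and t0: "t 0 < 1"
  shows "(\<lambda>i. t (Suc i) / (1 - t 0)) \<in> standard_simplex p"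
proof -
  have nn: "0 \<le> t i" and z: "i > Suc p \<Longrightarrow> t i = 0" for i
    using t by (auto simp: standard_simplex_def)
  have sum: "t 0 + (\<Sum>i\<le>p. t (Suc i)) = 1"
    using t by (simp add: standard_simplex_def sum.atMost_Suc_shift del: sum.atMost_Suc)
  have "t (Suc i) \<le> 1 - t 0" for i
  proof (cases "i \<le> p")
    case True
    then have "t (Suc i) \<le> (\<Sum>i\<le>p. t (Suc i))"
      using nn by (intro member_le_sum) auto
    with sum show ?thesis by simp
  qed (use z t0 in auto)
  moreover have "(\<Sum>i\<le>p. t (Suc i) / (1 - t 0)) = 1"
    using sum t0 by (simp flip: sum_divide_distrib)
  ultimately show ?thesis
    using nn z t0 by (auto simp: standard_simplex_def divide_le_eq)
qed

text \<open>On the closed half \<open>t 0 <= 1/2\<close> the denominator stays away from 0. On the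
  other half the map is constant, and both agree at \<open>t 0 = 1/2\<close>, where the contraction
  has reached time 1.\<close>

lemma singular_simplex_cone:
  assumes h: "continuous_map (prod_topology (top_of_set {0..1}) X) Y h"
    and h1: "\<And>x. x \<in> topspace X \<Longrightarrow> h (1, x) = a"
    and s: "singular_simplex p X s"
  shows "singular_simplex (Suc p) Y (cone_simplex h a p s)"
proof -
  let ?P = "subtopology (powertop_real UNIV) (standard_simplex (Suc p))"
  let ?Q = "subtopology ?P {t \<in> topspace ?P. t 0 \<le> 1/2}"
  have s_cont: "continuous_map (subtopology (powertop_real UNIV) (standard_simplex p)) X s"
    using s by (simp add: singular_simplex_def)
  have s_mem: "s t \<in> topspace X" if "t \<in> standard_simplex p" for t
    using continuous_map_funspace [OF s_cont] that by auto
  \<comment> \<open>The vertex \<open>a\<close> is known only as a value of \<open>h\<close>, so a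
    point of \<open>X\<close> is needed to place it in \<open>Y\<close>; the image of
    \<open>s\<close> supplies one.\<close>
  obtain x where x: "x \<in> topspace X"
    using s_mem nonempty_standard_simplex by fastforce
  have a: "a \<in> topspace Y"
    using continuous_map_funspace [OF h] x h1 by fastforce
  have proj: "continuous_map ?P euclideanreal (\<lambda>t. t i)" for i
    by (auto intro: continuous_map_from_subtopology continuous_map_product_projection)
  have projQ: "continuous_map ?Q euclideanreal (\<lambda>t. t i)" for i
    using proj by (rule continuous_map_from_subtopology)
  have "continuous_map ?Q (subtopology (powertop_real UNIV) (standard_simplex p)) (\<lambda>t i. t (Suc i) / (1 - t 0))"
    unfolding continuous_map_in_subtopology
  proof
    show "continuous_map ?Q (powertop_real UNIV) (\<lambda>t i. t (Suc i) / (1 - t 0))"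
      unfolding continuous_map_componentwise_UNIV
      by (intro allI continuous_map_real_divide continuous_map_diff projQ) auto
    show "(\<lambda>t i. t (Suc i) / (1 - t 0)) \<in> topspace ?Q \<rightarrow> standard_simplex p"
      by (auto intro: standard_simplex_tail)
  qed
  then have tail: "continuous_map ?Q X (\<lambda>t. s (\<lambda>i. t (Suc i) / (1 - t 0)))"
    using continuous_map_compose [OF _ s_cont] by (simp add: o_def)
  have "continuous_map ?Q (top_of_set {0..1}) (\<lambda>t. 2 * t 0)"
    unfolding continuous_map_in_subtopology
  proof
    show "continuous_map ?Q euclideanreal (\<lambda>t. 2 * t 0)"
      by (intro continuous_map_real_mult projQ) auto
    show "(\<lambda>t. 2 * t 0) \<in> topspace ?Q \<rightarrow> {0..1}"
      by (auto simp: standard_simplex_def)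
  qed
  then have "continuous_map ?Q (prod_topology (top_of_set {0..1}) X) (\<lambda>t. (2 * t 0, s (\<lambda>i. t (Suc i) / (1 - t 0))))"
    using tail by (simp add: continuous_map_pairwise o_def)
  then have lower: "continuous_map ?Q Y (\<lambda>t. h (2 * t 0, s (\<lambda>i. t (Suc i) / (1 - t 0))))"
    using continuous_map_compose [OF _ h] by (simp add: o_def)
  have "continuous_map ?P Y (\<lambda>t. if t 0 \<le> 1/2 then h (2 * t 0, s (\<lambda>i. t (Suc i) / (1 - t 0))) else a)"
  proof (rule continuous_map_cases_le)
    show "h (2 * t 0, s (\<lambda>i. t (Suc i) / (1 - t 0))) = a" if "t \<in> topspace ?P" "t 0 = 1/2" for t
    proof -
      have "2 * t 0 = 1" "t 0 < 1"
        using that by auto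
      moreover have "h (1, s (\<lambda>i. t (Suc i) / (1 - t 0))) = a"
        using that by (intro h1 s_mem standard_simplex_tail) auto
      ultimately show ?thesis
        by (simp only:)
    qed
  qed (use proj lower a in auto)
  then show ?thesis
    unfolding singular_simplex_def cone_simplex_def by simp
qed

text \<open>The face opposite the cone vertex has \<open>t 0 = 0\<close>, where the contraction is
  still the identity.\<close>

lemma singular_face_cone_0:
  assumes h0: "\<And>x. x \<in> topspace X \<Longrightarrow> h (0, x) = x" and s: "singular_simplex p X s"
  shows "singular_face (Suc p) 0 (cone_simplex h a p s) = s"
proof
  fix t
  have "s \<in> extensional (standard_simplex p)"
    and "t \<in> standard_simplex p \<Longrightarrow> s t \<in> topspace X"
    using s continuous_map_funspace by (fastforce simp: singular_simplex_def)+
  moreover have "t \<in> standard_simplex p \<Longrightarrow> simplical_face 0 t \<in> standard_simplex (Suc p)"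
    using simplical_face_in_standard_simplex [of "Suc p" 0 t] by simp
  ultimately show "singular_face (Suc p) 0 (cone_simplex h a p s) t = s t"
    by (auto simp: singular_face_def cone_simplex_def simplical_face_def h0 extensional_def)
qed

text \<open>The other faces contain the cone vertex and leave coordinate 0 alone, so taking them
  commutes with coning. A 0-simplex has no faces to cone, hence \<open>0 < p\<close>; the next lemma
  treats \<open>p = 0\<close>.\<close>

lemma singular_face_cone_Suc:
  assumes "0 < p" "k \<le> p"
  shows "singular_face (Suc p) (Suc k) (cone_simplex h a p s) = cone_simplex h a (p - 1) (singular_face p k s)"
proof
  fix t
  show "singular_face (Suc p) (Suc k) (cone_simplex h a p s) t = cone_simplex h a (p - 1) (singular_face p k s) t"
  proof (cases "t \<in> standard_simplex p")
    case True
    have t: "simplical_face (Suc k) t \<in> standard_simplex (Suc p)"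
      using simplical_face_in_standard_simplex [of "Suc p" "Suc k" t] True assms by simp
    have "(\<lambda>i. simplical_face (Suc k) t (Suc i) / (1 - t 0)) = simplical_face k (\<lambda>i. t (Suc i) / (1 - t 0))"
      using assms by (auto simp: simplical_face_def fun_eq_iff)
    moreover have "(\<lambda>i. t (Suc i) / (1 - t 0)) \<in> standard_simplex (p - 1)" if "t 0 \<le> 1/2"
      using standard_simplex_tail [of t "p - 1"] True assms that by simp
    ultimately show ?thesis
      using True t assms
      by (simp add: singular_face_def cone_simplex_def) (simp add: simplical_face_def)
  qed (use assms in \<open>auto simp: singular_face_def cone_simplex_def\<close>)
qed

lemma singular_face_cone_vertex:
  "singular_face (Suc 0) (Suc 0) (cone_simplex h a 0 s) = restrict (\<lambda>_. a) (standard_simplex 0)"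
proof
  fix t
  have "simplical_face (Suc 0) t \<in> standard_simplex (Suc 0)" if "t \<in> standard_simplex 0"
    using simplical_face_in_standard_simplex [of "Suc 0" "Suc 0" t] that by simp
  then show "singular_face (Suc 0) (Suc 0) (cone_simplex h a 0 s) t = restrict (\<lambda>_. a) (standard_simplex 0) t"
    by (auto simp: singular_face_def cone_simplex_def simplical_face_def standard_simplex_0)
qed

lemma cone_chain_mem:
  assumes h: "continuous_map (prod_topology (top_of_set {0..1}) X) Y h"
    and h1: "\<And>x. x \<in> topspace X \<Longrightarrow> h (1, x) = a"
    and c: "c \<in> coeff_chains (int p) X"
  shows "cone_chain h a p c \<in> coeff_chains (int (Suc p)) Y"
  unfolding cone_chain_def coeff_chains_nat
  using singular_simplex_cone [OF h h1]
  by (intro keys_linear_extend_subsetI [OF c [unfolded coeff_chains_nat]]) auto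

lemma coeff_boundary_single:
  "coeff_boundary (Suc p) (Poly_Mapping.single s (1::'c::comm_ring_1))
   = (\<Sum>k\<le>Suc p. Poly_Mapping.single (singular_face (Suc p) k s) ((- 1) ^ k))"
  by (simp add: coeff_boundary_def del: sum.atMost_Suc)

lemma coeff_boundary_linear_extend:
  "coeff_boundary p (linear_extend b c) = linear_extend (\<lambda>s. coeff_boundary p (b s)) c"
  by (simp add: coeff_boundary_def linear_extend_linear_extend) (simp add: linear_extend_def)

lemma coeff_boundary_cone_simplex:
  assumes h0: "\<And>x. x \<in> topspace X \<Longrightarrow> h (0, x) = x" and s: "singular_simplex p X s"
  shows "coeff_boundary (Suc p) (Poly_Mapping.single (cone_simplex h a p s) (1::'c::comm_ring_1))
       = Poly_Mapping.single s 1 -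
         (\<Sum>k\<le>p. Poly_Mapping.single (singular_face (Suc p) (Suc k) (cone_simplex h a p s)) ((- 1) ^ k))"
  unfolding coeff_boundary_single sum.atMost_Suc_shift
  by (simp add: singular_face_cone_0 [OF h0 s] single_uminus sum_negf)

text \<open>Face 0 returns \<open>c\<close>; the remaining faces are cones on the faces of
  \<open>c\<close>, with signs shifted by one index. Hence the cone operator is a chain contraction
  in positive degrees.\<close>

lemma coeff_boundary_cone_chain:
  assumes h0: "\<And>x. x \<in> topspace X \<Longrightarrow> h (0, x) = x"
    and c: "c \<in> coeff_chains (int (Suc p)) X"
  shows "coeff_boundary (Suc (Suc p)) (cone_chain h a (Suc p) c) = c - cone_chain h a p (coeff_boundary (Suc p) c)"
proof -
  have "coeff_boundary (Suc (Suc p)) (cone_chain h a (Suc p) c) =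
      linear_extend (\<lambda>s. Poly_Mapping.single s 1 - cone_chain h a p (coeff_boundary (Suc p) (Poly_Mapping.single s 1))) c"
    unfolding cone_chain_def coeff_boundary_linear_extend
  proof (rule linear_extend_cong)
    fix s assume "s \<in> Poly_Mapping.keys c"
    then have "singular_simplex (Suc p) X s"
      using c by (auto simp: coeff_chains_nat simp del: of_nat_Suc)
    then show "coeff_boundary (Suc (Suc p)) (Poly_Mapping.single (cone_simplex h a (Suc p) s) 1) =
      Poly_Mapping.single s 1 - linear_extend (\<lambda>s. Poly_Mapping.single (cone_simplex h a p s) 1)
         (coeff_boundary (Suc p) (Poly_Mapping.single s 1))"
      by (subst coeff_boundary_cone_simplex [OF h0])
        (simp_all add: coeff_boundary_single linear_extend_sum singular_face_cone_Suc del: sum.atMost_Suc)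
  qed
  also have "\<dots> = c - cone_chain h a p (coeff_boundary (Suc p) c)"
    by (simp add: linear_extend_diff_fun cone_chain_def coeff_boundary_def linear_extend_linear_extend)
  finally show ?thesis .
qed

text \<open>In degree 0 the contraction identity fails by the augmentation of \<open>c\<close>,
  carried by the constant simplex at \<open>a\<close>.\<close>

lemma coeff_boundary_cone_chain_0:
  assumes h0: "\<And>x. x \<in> topspace X \<Longrightarrow> h (0, x) = x"
    and c: "c \<in> coeff_chains (int 0) X"
  shows "coeff_boundary (Suc 0) (cone_chain h a 0 c) =
    c - Poly_Mapping.single (restrict (\<lambda>_. a) (standard_simplex 0)) (\<Sum>s\<in>Poly_Mapping.keys c. Poly_Mapping.lookup c s)"
proof -
  have "coeff_boundary (Suc 0) (cone_chain h a 0 c) =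
      linear_extend (\<lambda>s. Poly_Mapping.single s 1 - Poly_Mapping.single (restrict (\<lambda>_. a) (standard_simplex 0)) 1) c"
    unfolding cone_chain_def coeff_boundary_linear_extend
    using c unfolding coeff_chains_nat
    by (intro linear_extend_cong) (auto simp: coeff_boundary_cone_simplex [OF h0] singular_face_cone_vertex)
  also have "\<dots> = c - (\<Sum>s\<in>Poly_Mapping.keys c. Poly_Mapping.single (restrict (\<lambda>_. a) (standard_simplex 0)) (Poly_Mapping.lookup c s))"
    by (simp add: linear_extend_diff_fun) (simp add: linear_extend_def)
  also have "(\<Sum>s\<in>Poly_Mapping.keys c. Poly_Mapping.single (restrict (\<lambda>_. a) (standard_simplex 0)) (Poly_Mapping.lookup c s))
     = Poly_Mapping.single (restrict (\<lambda>_. a) (standard_simplex 0)) (\<Sum>s\<in>Poly_Mapping.keys c. Poly_Mapping.lookup c s)"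
    by (rule poly_mapping_eqI) (simp add: lookup_sum lookup_single when_def)
  finally show ?thesis .
qed

section \<open>Finite rank modulo a submodule\<close>

text \<open>If \<open>A\<close> and \<open>B\<close> are submodules, this bounds the rank of the
  image of \<open>A\<close> modulo \<open>B\<close> by a number below \<open>N\<close>;
  \<open>N = 0\<close> never qualifies. Arbitrary sets are allowed, so intermediate sets can be used
  without closure proofs. Tuples, unlike sets, may repeat an element.\<close>

definition finite_rank_mod :: "('b \<Rightarrow>\<^sub>0 'c::comm_ring_1) set \<Rightarrow> ('b \<Rightarrow>\<^sub>0 'c) set \<Rightarrow> bool" where
  "finite_rank_mod A B \<longleftrightarrow>
     (\<exists>N::nat. \<forall>z. (\<forall>i<N. z i \<in> A) \<longrightarrow>
        (\<exists>a. (\<exists>i<N. a i \<noteq> 0) \<and> (\<Sum>i<N. scale_chain (a i) (z i)) \<in> B))"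

lemma finite_rank_mod_mono:
  assumes "finite_rank_mod A B" "A' \<subseteq> A" "B \<subseteq> B'"
  shows "finite_rank_mod A' B'"
proof -
  obtain N :: nat where "\<And>z. (\<forall>i<N. z i \<in> A) \<Longrightarrow>
      (\<exists>a. (\<exists>i<N. a i \<noteq> 0) \<and> (\<Sum>i<N. scale_chain (a i) (z i)) \<in> B)"
    using assms(1) unfolding finite_rank_mod_def by blast
  then show ?thesis
    unfolding finite_rank_mod_def using assms(2,3) by (intro exI [of _ N]) blast
qed

lemma finite_rank_mod_subset:
  assumes "A \<subseteq> B"
  shows "finite_rank_mod A B"
  unfolding finite_rank_mod_def
  \<comment> \<open>Rank 0 means \<open>N = 1\<close>: a single element is its own relation, with
    coefficient 1.\<close>
  using assms by (intro exI [of _ 1] allI impI exI [of _ "\<lambda>_. 1"]) auto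

text \<open>Each of \<open>N1\<close> blocks of \<open>N'\<close> elements of \<open>A\<close> has a nontrivial combination in \<open>A1\<close>, and these
  \<open>N1\<close> elements have a nontrivial combination in \<open>B1\<close>; coefficients multiply to nonzero ones
  because there are no zero divisors.\<close>

lemma finite_rank_mod_blocks:
  fixes A B1 :: "('b \<Rightarrow>\<^sub>0 'c::idom) set" and A' B' :: "('d \<Rightarrow>\<^sub>0 'c) set"
  assumes add: "\<And>x x' y y'. R x y \<Longrightarrow> R x' y' \<Longrightarrow> R (x + x') (y + y')"
    and scale: "\<And>a x y. R x y \<Longrightarrow> R (scale_chain a x) (scale_chain a y)"
    and zero: "R 0 0"
    and total: "\<And>x. x \<in> A \<Longrightarrow> \<exists>y\<in>A'. R x y"
    and reduce: "\<And>x y. R x y \<Longrightarrow> y \<in> B' \<Longrightarrow> x \<in> A1"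
    and rank: "finite_rank_mod A' B'" "finite_rank_mod A1 B1"
  shows "finite_rank_mod A B1"
proof -
  obtain N' :: nat where N': "\<And>z. (\<forall>i<N'. z i \<in> A') \<Longrightarrow>
      (\<exists>a. (\<exists>i<N'. a i \<noteq> 0) \<and> (\<Sum>i<N'. scale_chain (a i) (z i)) \<in> B')"
    using rank(1) unfolding finite_rank_mod_def by blast
  obtain N1 :: nat where N1: "\<And>z. (\<forall>i<N1. z i \<in> A1) \<Longrightarrow>
      (\<exists>a. (\<exists>i<N1. a i \<noteq> 0) \<and> (\<Sum>i<N1. scale_chain (a i) (z i)) \<in> B1)"
    using rank(2) unfolding finite_rank_mod_def by blast
  have "\<exists>c. (\<exists>i<N1*N'. c i \<noteq> 0) \<and> (\<Sum>i<N1*N'. scale_chain (c i) (z i)) \<in> B1"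
    if z: "\<forall>i<N1*N'. z i \<in> A" for z
  proof -
    have index: "j * N' + k < N1 * N'" if "j < N1" "k < N'" for j k
    proof -
      have "j * N' + k < Suc j * N'"
        using that by simp
      also have "\<dots> \<le> N1 * N'"
        using that by (intro mult_le_mono1) simp
      finally show ?thesis .
    qed
    \<comment> \<open>The choice of \<open>y\<close> need not be linear in \<open>z\<close>; it is
      enough that \<open>R\<close> is closed under linear combinations.\<close>
    obtain y :: "nat \<Rightarrow> 'd \<Rightarrow>\<^sub>0 'c" where y: "\<And>i. i < N1*N' \<Longrightarrow> y i \<in> A' \<and> R (z i) (y i)"
    proof -
      have "\<forall>i\<in>{..<N1*N'}. \<exists>y. y \<in> A' \<and> R (z i) y"
        using total z by blast
      from bchoice [OF this] show ?thesis
        using that by blast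
    qed
    have "\<exists>a. (\<exists>k<N'. a k \<noteq> 0) \<and> (\<Sum>k<N'. scale_chain (a k) (y (j * N' + k))) \<in> B'" if "j < N1" for j
      by (rule N') (use y index that in blast)
    then obtain a where a: "\<And>j. j < N1 \<Longrightarrow> (\<exists>k<N'. a j k \<noteq> 0)"
      "\<And>j. j < N1 \<Longrightarrow> (\<Sum>k<N'. scale_chain (a j k) (y (j * N' + k))) \<in> B'"
      by metis
    define x where "x j = (\<Sum>k<N'. scale_chain (a j k) (z (j * N' + k)))" for j
    have "R (\<Sum>k\<in>K. scale_chain (a j k) (z (j * N' + k))) (\<Sum>k\<in>K. scale_chain (a j k) (y (j * N' + k)))"
      if "j < N1" "finite K" "K \<subseteq> {..<N'}" for j K
      using that(2,3) by induction (use y index that(1) zero in \<open>auto intro!: add scale\<close>)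
    then have "\<forall>j<N1. x j \<in> A1"
      unfolding x_def using a(2) reduce by blast
    from N1 [OF this] obtain b j where b: "j < N1" "b j \<noteq> 0" "(\<Sum>j<N1. scale_chain (b j) (x j)) \<in> B1"
      by blast
    obtain k where k: "k < N'" "a j k \<noteq> 0"
      using a(1) b(1) by blast
    \<comment> \<open>Entry \<open>k\<close> of block \<open>j\<close> has index
      \<open>j * N' + k\<close>, so quotient and remainder by \<open>N'\<close> recover the two
      coefficients to be multiplied.\<close>
    define c where "c i = b (i div N') * a (i div N') (i mod N')" for i
    have "(\<Sum>i<N1*N'. scale_chain (c i) (z i)) = (\<Sum>j<N1. \<Sum>i=j*N'..<j*N'+N'. scale_chain (c i) (z i))"
      by (rule sum.nat_group [symmetric])
    also have "\<dots> = (\<Sum>j<N1. \<Sum>k<N'. scale_chain (c (j * N' + k)) (z (j * N' + k)))"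
    proof (rule sum.cong)
      show "(\<Sum>i=j*N'..<j*N'+N'. scale_chain (c i) (z i)) = (\<Sum>k<N'. scale_chain (c (j * N' + k)) (z (j * N' + k)))" for j
        using sum.shift_bounds_nat_ivl [of "\<lambda>i. scale_chain (c i) (z i)" 0 "j * N'" N']
        by (simp add: atLeast0LessThan add.commute)
    qed simp
    also have "\<dots> = (\<Sum>j<N1. scale_chain (b j) (x j))"
      by (simp add: c_def x_def scale_chain_sum)
    finally have "(\<Sum>i<N1*N'. scale_chain (c i) (z i)) \<in> B1"
      using b by simp
    moreover have "c (j * N' + k) \<noteq> 0"
      using k b by (simp add: c_def)
    ultimately show ?thesis
      using index k b by blast
  qed
  then show ?thesis
    unfolding finite_rank_mod_def by blast
qed

section \<open>Finite rank of inclusions in homology\<close>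

definition finite_rank_inclusion ::
    "'c::comm_ring_1 itself \<Rightarrow> int \<Rightarrow> 'a topology \<Rightarrow> 'a set \<Rightarrow> 'a set \<Rightarrow> bool" where
  "finite_rank_inclusion _ q X V U \<longleftrightarrow>
     finite_rank_mod (coeff_cycles q (subtopology X V) :: ('a, 'c) coeff_chain set)
       (coeff_boundaries q (subtopology X U))"

lemma finite_rank_inclusion_mono:
  assumes "finite_rank_inclusion TYPE('c::comm_ring_1) q X V U" "V' \<subseteq> V" "U \<subseteq> U'"
  shows "finite_rank_inclusion TYPE('c) q X V' U'"
  using assms unfolding finite_rank_inclusion_def
  by (meson finite_rank_mod_mono coeff_cycles_mono coeff_boundaries_mono)

lemma finite_rank_inclusion_negative:
  "q < 0 \<Longrightarrow> finite_rank_inclusion TYPE('c::comm_ring_1) q X V U"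
  unfolding finite_rank_inclusion_def
  by (rule finite_rank_mod_subset) (auto simp: coeff_cycles_def coeff_chains_def coeff_boundaries_linear)

text \<open>In positive degree the cone on a cycle bounds it, giving rank 0. In degree 0 a cycle is
  homologous to its augmentation times one fixed vertex, so the rank is at most 1 and any two cycles
  are related.\<close>

lemma finite_rank_mod_contractible:
  fixes h :: "real \<times> 'a \<Rightarrow> 'a"
  assumes h: "continuous_map (prod_topology (top_of_set {0..1}) X) Y h"
    and h0: "\<And>x. x \<in> topspace X \<Longrightarrow> h (0, x) = x"
    and h1: "\<And>x. x \<in> topspace X \<Longrightarrow> h (1, x) = a"
  shows "finite_rank_mod (coeff_cycles (int p) X :: ('a, 'c::idom) coeff_chain set) (coeff_boundaries (int p) Y)"
proof (cases p)
  case (Suc r)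
  have "coeff_cycles (int p) X \<subseteq> (coeff_boundaries (int p) Y :: ('a, 'c) coeff_chain set)"
  proof
    fix z :: "('a, 'c) coeff_chain"
    assume "z \<in> coeff_cycles (int p) X"
    then have z: "z \<in> coeff_chains (int p) X" "coeff_boundary p z = 0"
      by (auto simp: coeff_cycles_nat)
    then have "z = coeff_boundary (Suc p) (cone_chain h a p z)"
      using coeff_boundary_cone_chain [of X h z r a] h0 Suc
      by (simp add: cone_chain_def)
    then show "z \<in> coeff_boundaries (int p) Y"
      using cone_chain_mem [OF h h1 z(1)] unfolding coeff_boundaries_nat by blast
  qed
  then show ?thesis
    by (rule finite_rank_mod_subset)
next
  case 0
  define \<epsilon> :: "('a, 'c) coeff_chain \<Rightarrow> 'c" where "\<epsilon> c = (\<Sum>s\<in>Poly_Mapping.keys c. Poly_Mapping.lookup c s)" for c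
  define v :: "(nat \<Rightarrow> real) \<Rightarrow> 'a" where "v = restrict (\<lambda>_. a) (standard_simplex 0)"
  have cone: "c - Poly_Mapping.single v (\<epsilon> c) \<in> coeff_boundaries (int 0) Y" if "c \<in> coeff_cycles (int 0) X" for c
    using that coeff_boundary_cone_chain_0 [of X h c a] cone_chain_mem [OF h h1, of c 0] h0
    unfolding coeff_boundaries_nat coeff_cycles_nat \<epsilon>_def v_def by metis
  have "\<exists>b. (\<exists>i<2. b i \<noteq> 0) \<and> (\<Sum>i<2. scale_chain (b i) (z i)) \<in> coeff_boundaries (int 0) Y"
    if z: "\<forall>i<2::nat. z i \<in> coeff_cycles (int 0) X" for z :: "nat \<Rightarrow> ('a, 'c) coeff_chain"
  proof (cases "\<epsilon> (z 0) = 0")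
    case True
    then show ?thesis
      using cone [of "z 0"] z
      by (intro exI [of _ "\<lambda>i. if i = 0 then 1 else 0"]) (auto simp: numeral_2_eq_2)
  next
    case False
    let ?d = "\<lambda>i. z i - Poly_Mapping.single v (\<epsilon> (z i))"
    \<comment> \<open>Cross-multiplying by the augmentations cancels the vertex terms; the
      coefficient of \<open>z 1\<close> is nonzero in this case.\<close>
    have "scale_chain (\<epsilon> (z 1)) (?d 0) + scale_chain (- \<epsilon> (z 0)) (?d 1) \<in> coeff_boundaries (int 0) Y"
      using z by (intro coeff_boundaries_linear cone) auto
    also have "scale_chain (\<epsilon> (z 1)) (?d 0) + scale_chain (- \<epsilon> (z 0)) (?d 1) =
        scale_chain (\<epsilon> (z 1)) (z 0) + scale_chain (- \<epsilon> (z 0)) (z 1)"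
      by (simp add: scale_chain_diff single_uminus mult.commute)
    finally show ?thesis
      using False
      by (intro exI [of _ "\<lambda>i. if i = 0 then \<epsilon> (z 1) else - \<epsilon> (z 0)"]) (auto simp: numeral_2_eq_2)
  qed
  then show ?thesis
    unfolding finite_rank_mod_def 0 by blast
qed

section \<open>A Mayer-Vietoris estimate for ranks\<close>

text \<open>This includes \<open>p = 0\<close>, where the right-hand side is zero, so the
  obstruction in degree \<open>p - 1\<close> is uniform in \<open>p\<close>.\<close>

lemma coeff_boundaries_pred:
  "coeff_boundaries (int p - 1) X = coeff_boundary p ` coeff_chains (int p) X"
  by (simp add: coeff_boundaries_def)

lemma coeff_chains_Int:
  "coeff_chains q (subtopology X V1) \<inter> coeff_chains q (subtopology X V2) \<subseteq> coeff_chains q (subtopology X (V1 \<inter> V2))"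
  by (auto simp: coeff_chains_def singular_simplex_subtopology subset_iff image_subset_iff split: if_splits)

text \<open>A cycle of \<open>V1 \<union> V2\<close> is homologous to a sum \<open>x + y\<close> of chains of \<open>V1\<close> and \<open>V2\<close>. The class of the
  boundary of \<open>x\<close>, then those of the two cycles into which the sum splits when the first class
  vanishes, are the three obstructions of finite rank.\<close>

lemma finite_rank_inclusion_Un:
  fixes X :: "'a topology"
  assumes V: "openin X V1" "openin X V2" and N: "V1 \<subseteq> N1" "V2 \<subseteq> N2" "N1 \<subseteq> U" "N2 \<subseteq> U"
    and r12: "finite_rank_inclusion TYPE('c::idom) (int p - 1) X (V1 \<inter> V2) (N1 \<inter> N2)"
    and r1: "finite_rank_inclusion TYPE('c) (int p) X N1 U"
    and r2: "finite_rank_inclusion TYPE('c) (int p) X N2 U"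
  shows "finite_rank_inclusion TYPE('c) (int p) X (V1 \<union> V2) U"
proof -
  let ?C = "\<lambda>V. coeff_chains (int p) (subtopology X V) :: ('a, 'c) coeff_chain set"
  let ?Z = "\<lambda>V. coeff_cycles (int p) (subtopology X V) :: ('a, 'c) coeff_chain set"
  let ?B = "coeff_boundaries (int p) (subtopology X U) :: ('a, 'c) coeff_chain set"
  let ?Z12 = "coeff_cycles (int p - 1) (subtopology X (V1 \<inter> V2)) :: ('a, 'c) coeff_chain set"
  let ?B12 = "coeff_boundaries (int p - 1) (subtopology X (N1 \<inter> N2)) :: ('a, 'c) coeff_chain set"
  let ?d = "coeff_boundary p"
  have B_mono: "x \<in> ?B" if "x \<in> coeff_boundaries (int p) (subtopology X V)" "V \<subseteq> U" for x V
    using that coeff_boundaries_mono by blast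
  note lin = coeff_cycles_linear coeff_boundaries_linear coeff_chains_linear
  \<comment> \<open>The last obstruction comes first, because each use of
    \<open>finite_rank_mod_blocks\<close> needs the rank of the set that remains once its
    obstruction vanishes.\<close>
  define R3 where "R3 z y \<longleftrightarrow> y \<in> ?Z N2 \<and> (\<exists>e\<in>?B. z = y + e)" for z y
  define A2 where "A2 = {z. \<exists>y. R3 z y}"
  have "finite_rank_mod A2 ?B"
  proof (rule finite_rank_mod_blocks [where R = R3 and A' = "?Z N2" and B' = ?B and ?A1.0 = ?B])
    show "R3 (x + x') (y + y')" if "R3 x y" "R3 x' y'" for x x' y y'
    proof -
      obtain e e' where "e \<in> ?B" "e' \<in> ?B" "x = y + e" "x' = y' + e'"
        using \<open>R3 x y\<close> \<open>R3 x' y'\<close> unfolding R3_def by blast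
      then have "x + x' = (y + y') + (e + e')" "e + e' \<in> ?B"
        by (simp_all only: add_ac lin)
      moreover have "y + y' \<in> ?Z N2"
        using that by (auto simp: R3_def lin)
      ultimately show ?thesis
        unfolding R3_def by blast
    qed
    show "R3 (scale_chain a x) (scale_chain a y)" if "R3 x y" for a x y
    proof -
      obtain e where "e \<in> ?B" "x = y + e"
        using \<open>R3 x y\<close> unfolding R3_def by blast
      then have "scale_chain a x = scale_chain a y + scale_chain a e" "scale_chain a e \<in> ?B"
        by (simp_all add: lin scale_chain_add)
      moreover have "scale_chain a y \<in> ?Z N2"
        using that by (auto simp: R3_def lin)
      ultimately show ?thesis
        unfolding R3_def by blast
    qed
    show "x \<in> ?B" if "R3 x y" "y \<in> ?B" for x y
      using that by (auto simp: R3_def lin)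
    show "R3 0 0"
      unfolding R3_def by (intro conjI bexI [of _ 0] lin) simp
    show "\<exists>y\<in>?Z N2. R3 z y" if "z \<in> A2" for z
      using that unfolding A2_def unfolding R3_def by blast
  qed (use r2 in \<open>simp_all add: finite_rank_inclusion_def finite_rank_mod_subset\<close>)
  define R2 where "R2 z x \<longleftrightarrow> x \<in> ?Z N1 \<and> (\<exists>y\<in>?Z N2. \<exists>e\<in>?B. z = x + y + e)" for z x
  define A1 where "A1 = {z. \<exists>x. R2 z x}"
  have "finite_rank_mod A1 ?B"
  proof (rule finite_rank_mod_blocks [where R = R2 and A' = "?Z N1" and B' = ?B and ?A1.0 = A2])
    show "R2 (x + x') (y + y')" if "R2 x y" "R2 x' y'" for x x' y y'
    proof -
      obtain w e w' e' where "e \<in> ?B" "e' \<in> ?B" "w \<in> ?Z N2" "w' \<in> ?Z N2" "x = y + w + e" "x' = y' + w' + e'"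
        using \<open>R2 x y\<close> \<open>R2 x' y'\<close> unfolding R2_def by blast
      then have "x + x' = (y + y') + (w + w') + (e + e')" "e + e' \<in> ?B" "w + w' \<in> ?Z N2"
        by (simp_all only: add_ac lin)
      moreover have "y + y' \<in> ?Z N1"
        using that by (auto simp: R2_def lin)
      ultimately show ?thesis
        unfolding R2_def by blast
    qed
    show "R2 (scale_chain a x) (scale_chain a y)" if "R2 x y" for a x y
    proof -
      obtain w e where "e \<in> ?B" "w \<in> ?Z N2" "x = y + w + e"
        using \<open>R2 x y\<close> unfolding R2_def by blast
      then have "scale_chain a x = scale_chain a y + scale_chain a w + scale_chain a e"
        "scale_chain a e \<in> ?B" "scale_chain a w \<in> ?Z N2"
        by (simp_all add: lin scale_chain_add)
      moreover have "scale_chain a y \<in> ?Z N1"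
        using that by (auto simp: R2_def lin)
      ultimately show ?thesis
        unfolding R2_def by blast
    qed
    show "z \<in> A2" if "R2 z x" "x \<in> ?B" for z x
    proof -
      obtain w e where "e \<in> ?B" "w \<in> ?Z N2" "z = x + w + e"
        using \<open>R2 z x\<close> unfolding R2_def by blast
      moreover from this have "z = w + (x + e)" "x + e \<in> ?B"
        using that(2) by (simp_all add: lin)
      ultimately have "R3 z w"
        unfolding R3_def by blast
      then show ?thesis
        by (auto simp: A2_def)
    qed
    show "R2 0 0"
      unfolding R2_def by (intro conjI bexI [of _ 0] lin) simp
    show "\<exists>x\<in>?Z N1. R2 z x" if "z \<in> A1" for z
      using that unfolding A1_def unfolding R2_def by blast
  qed (use r1 \<open>finite_rank_mod A2 ?B\<close> in \<open>simp_all add: finite_rank_inclusion_def\<close>)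
  \<comment> \<open>Here \<open>t\<close> represents the Mayer-Vietoris connecting homomorphism on
    \<open>z\<close>. It depends on the decomposition of \<open>z\<close>, hence a relation instead
    of a map.\<close>
  define R1 where "R1 z t \<longleftrightarrow> ?d z = 0 \<and> (\<exists>x\<in>?C V1. \<exists>y\<in>?C V2. \<exists>e\<in>?B. z = x + y + e \<and> t = ?d x)" for z t
  have "finite_rank_mod (?Z (V1 \<union> V2)) ?B"
  proof (rule finite_rank_mod_blocks [where R = R1 and A' = ?Z12 and B' = ?B12 and ?A1.0 = A1])
    show "R1 (z + z') (t + t')" if "R1 z t" "R1 z' t'" for z z' t t'
    proof -
      obtain x y e where 1: "x \<in> ?C V1" "y \<in> ?C V2" "e \<in> ?B" "z = x + y + e" "t = ?d x" "?d z = 0"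
        using \<open>R1 z t\<close> unfolding R1_def by blast
      obtain x' y' e' where 2: "x' \<in> ?C V1" "y' \<in> ?C V2" "e' \<in> ?B" "z' = x' + y' + e'" "t' = ?d x'" "?d z' = 0"
        using \<open>R1 z' t'\<close> unfolding R1_def by blast
      have "z + z' = (x + x') + (y + y') + (e + e')" "t + t' = ?d (x + x')" "?d (z + z') = 0"
        using 1 2 coeff_boundary_linear(1)[of p z z'] by (simp_all add: coeff_boundary_linear(1)[of p x x'])
      moreover have "x + x' \<in> ?C V1" "y + y' \<in> ?C V2" "e + e' \<in> ?B"
        using 1 2 by (simp_all add: lin)
      ultimately show ?thesis
        unfolding R1_def by blast
    qed
    show "R1 (scale_chain a z) (scale_chain a t)" if "R1 z t" for a z t
    proof -
      obtain x y e where 1: "x \<in> ?C V1" "y \<in> ?C V2" "e \<in> ?B" "z = x + y + e" "t = ?d x" "?d z = 0"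
        using \<open>R1 z t\<close> unfolding R1_def by blast
      have "scale_chain a z = scale_chain a x + scale_chain a y + scale_chain a e"
        "scale_chain a t = ?d (scale_chain a x)" "?d (scale_chain a z) = 0"
        using 1 coeff_boundary_linear(3)[of p a z] by (simp_all add: coeff_boundary_linear(3) scale_chain_add)
      moreover have "scale_chain a x \<in> ?C V1" "scale_chain a y \<in> ?C V2" "scale_chain a e \<in> ?B"
        using 1 by (simp_all add: lin)
      ultimately show ?thesis
        unfolding R1_def by blast
    qed
    show "R1 0 0"
      unfolding R1_def by (intro conjI bexI [of _ 0]) (simp_all add: lin coeff_boundary_linear)
    show "\<exists>t\<in>?Z12. R1 z t" if "z \<in> ?Z (V1 \<union> V2)" for z
    proof -
      have V': "openin (subtopology X (V1 \<union> V2)) V1" "openin (subtopology X (V1 \<union> V2)) V2"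
        "topspace (subtopology X (V1 \<union> V2)) = V1 \<union> V2"
        using V openin_subset by (fastforce simp: openin_subtopology)+
      have inter: "V1 \<inter> (V1 \<union> V2) = V1" "V2 \<inter> (V1 \<union> V2) = V2" "(V1 \<union> V2) \<inter> V1 = V1" "(V1 \<union> V2) \<inter> V2 = V2"
        by auto
      obtain x y e where x: "x \<in> ?C V1" and y: "y \<in> ?C V2"
        and e: "e \<in> coeff_chains (int (Suc p)) (subtopology X (V1 \<union> V2))" and z: "z = x + y + coeff_boundary (Suc p) e"
        by (rule coeff_cycle_subdivide [OF V' \<open>z \<in> ?Z (V1 \<union> V2)\<close>]) (simp add: subtopology_subtopology inter)
      have dz: "?d z = 0"
        using that by (simp add: coeff_cycles_nat)
      have e': "coeff_boundary (Suc p) e \<in> ?B"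
        using e N by (intro B_mono [of _ "V1 \<union> V2"]) (auto simp: coeff_boundaries_nat)
      \<comment> \<open>Since \<open>z\<close> is a cycle, the boundaries of \<open>x\<close> and
        \<open>y\<close> cancel. So \<open>?d x\<close> is a chain of both \<open>V1\<close> and
        \<open>V2\<close>, hence of their intersection.\<close>
      have dx: "?d x = ?d (scale_chain (- 1) y)"
        using dz coeff_boundary_boundary [OF e] unfolding z coeff_boundary_linear
        by (simp add: scale_chain_minus_one eq_neg_iff_add_eq_0)
      have "?d x \<in> ?Z12"
      proof (cases p)
        case 0
        then show ?thesis
          by (simp add: coeff_boundary_def coeff_cycles_linear)
      next
        case (Suc r)
        have *: "scale_chain (- 1) y \<in> ?C V2"
          using y by (rule lin)
        have "?d x \<in> coeff_chains (int r) (subtopology X V1)"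
          using x unfolding Suc by (rule coeff_boundary_mem)
        moreover have "?d x \<in> coeff_chains (int r) (subtopology X V2)"
          using * unfolding dx unfolding Suc by (rule coeff_boundary_mem)
        ultimately have "?d x \<in> coeff_chains (int r) (subtopology X (V1 \<inter> V2))"
          using coeff_chains_Int by blast
        moreover have "coeff_boundary r (?d x) = 0"
          using x unfolding Suc by (rule coeff_boundary_boundary)
        moreover have "int p - 1 = int r"
          using Suc by simp
        ultimately show ?thesis
          by (simp add: coeff_cycles_nat)
      qed
      moreover have "R1 z (?d x)"
        using x y e' z dz unfolding R1_def by blast
      ultimately show ?thesis by blast
    qed
    show "z \<in> A1" if "R1 z t" "t \<in> ?B12" for z t
    proof -
      obtain x y e where 1: "x \<in> ?C V1" "y \<in> ?C V2" "e \<in> ?B" "z = x + y + e" "t = ?d x" "?d z = 0"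
        using \<open>R1 z t\<close> unfolding R1_def by blast
      \<comment> \<open>Moving \<open>w\<close> from \<open>x\<close> to \<open>y\<close> turns both
        summands into cycles: \<open>w\<close> lies in \<open>N1\<close> and in \<open>N2\<close>
        and has the same boundary as \<open>x\<close>.\<close>
      obtain w where w: "w \<in> ?C (N1 \<inter> N2)" "t = ?d w"
        using \<open>t \<in> ?B12\<close> unfolding coeff_boundaries_pred by blast
      have C: "x \<in> ?C N1" "y \<in> ?C N2" "w \<in> ?C N1" "w \<in> ?C N2"
        using 1 w N coeff_chains_mono [of _ _ "int p" X] by blast+
      have "?d e = 0"
        using 1(3) coeff_boundaries_subset_cycles by (fastforce simp: coeff_cycles_nat)
      then have "?d (y + w) = 0"
        using 1 w by (simp add: coeff_boundary_linear add.commute)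
      then have "x - w \<in> ?Z N1" "y + w \<in> ?Z N2"
        using C 1 w by (auto simp: coeff_cycles_nat lin coeff_chains_diff coeff_boundary_linear)
      moreover have "z = (x - w) + (y + w) + e"
        using 1 by simp
      ultimately have "R2 z (x - w)"
        using 1(3) unfolding R2_def by blast
      then show ?thesis
        by (auto simp: A1_def)
    qed
  qed (use r12 \<open>finite_rank_mod A1 ?B\<close> in \<open>simp_all add: finite_rank_inclusion_def\<close>)
  then show ?thesis
    by (simp add: finite_rank_inclusion_def)
qed

section \<open>Compact subsets of locally contractible spaces\<close>

text \<open>The neighbourhood given by local contractibility need not be open; an open set inside it
  inherits the rank bound.\<close>

lemma finite_rank_inclusion_locally:
  fixes Y :: "'a topology"
  assumes "locally_contractible_space Y" "openin Y N" "x \<in> N"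
  obtains W where "openin Y W" "x \<in> W" "W \<subseteq> N" "finite_rank_inclusion TYPE('c::idom) (int p) Y W N"
proof -
  have "x \<in> topspace Y" "neighbourhood_in Y x N"
    using assms openin_subset unfolding neighbourhood_in_def by blast+
  then obtain V a where V: "neighbourhood_in Y x V" "V \<subseteq> N"
    and "homotopic_with (\<lambda>_. True) (subtopology Y V) (subtopology Y N) id (\<lambda>_. a)"
    using assms(1) unfolding locally_contractible_space_def by metis
  then obtain h :: "real \<times> 'a \<Rightarrow> 'a" where "continuous_map (prod_topology (top_of_set {0..1}) (subtopology Y V)) (subtopology Y N) h"
    "\<And>x. h (0, x) = x" "\<And>x. h (1, x) = a"
    by (auto simp: homotopic_with_def)
  then have V_N: "finite_rank_inclusion TYPE('c) (int p) Y V N"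
    unfolding finite_rank_inclusion_def by (rule finite_rank_mod_contractible)
  obtain W where W: "openin Y W" "x \<in> W" "W \<subseteq> V"
    using V unfolding neighbourhood_in_def by blast
  show thesis
    using that [OF W(1,2)] W(3) V(2) finite_rank_inclusion_mono [OF V_N W(3) order_refl] by blast
qed

lemma finite_rank_inclusion_empty:
  fixes Y :: "'a topology"
  shows "finite_rank_inclusion TYPE('c::comm_ring_1) q Y {} U"
proof -
  have "coeff_cycles q (subtopology Y {}) \<subseteq> {0 :: ('a, 'c) coeff_chain}"
  proof -
    have "c = 0" if "c \<in> coeff_chains q (subtopology Y {})" for c :: "('a, 'c) coeff_chain"
    proof -
      have "Poly_Mapping.keys c = {} \<or> c = 0"
        using that singular_simplex_empty [of "subtopology Y {}"]
        by (fastforce simp: coeff_chains_def split: if_splits)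
      then show ?thesis by simp
    qed
    then show ?thesis
      unfolding coeff_cycles_def by blast
  qed
  then show ?thesis
    unfolding finite_rank_inclusion_def
    by (intro finite_rank_mod_subset) (use coeff_boundaries_linear(1) in blast)
qed

text \<open>Outside the open set \<open>G\<close> that cuts out \<open>W12\<close>, the compact sets
  \<open>K1\<close> and \<open>K2\<close> do not meet and can be separated. This yields
  neighbourhoods overlapping only inside \<open>W12\<close>.\<close>

lemma finite_rank_open_neighbourhood_Un:
  fixes X :: "'a::euclidean_space set"
  assumes K: "compact K1" "compact K2" "K1 \<subseteq> N1" "K2 \<subseteq> N2" "N1 \<union> N2 \<subseteq> N"
    and N: "openin (top_of_set X) N1" "openin (top_of_set X) N2"
    and r1: "finite_rank_inclusion TYPE('c::idom) (int p) (top_of_set X) N1 N"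
    and r2: "finite_rank_inclusion TYPE('c) (int p) (top_of_set X) N2 N"
    and W12: "openin (top_of_set X) W12" "K1 \<inter> K2 \<subseteq> W12" "W12 \<subseteq> N1 \<inter> N2"
    and r12: "finite_rank_inclusion TYPE('c) (int p - 1) (top_of_set X) W12 (N1 \<inter> N2)"
  obtains W where "openin (top_of_set X) W" "K1 \<union> K2 \<subseteq> W" "W \<subseteq> N"
    "finite_rank_inclusion TYPE('c) (int p) (top_of_set X) W N"
proof -
  obtain G where G: "open G" "W12 = X \<inter> G"
    using W12(1) by (auto simp: openin_open)
  have X: "K1 \<subseteq> X" "K2 \<subseteq> X"
    using K N openin_imp_subset by blast+
  have "compact (K1 - G)"
    using K(1) G(1) by (rule compact_diff)
  moreover have "(K1 - G) \<inter> K2 = {}"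
    using W12(2) G(2) X by blast
  ultimately obtain O1 O2 where O: "open O1" "open O2" "K1 - G \<subseteq> O1" "K2 \<subseteq> O2" "O1 \<inter> O2 = {}"
    using compact_imp_closed [OF K(2)] by (auto intro: separation_normal_compact [of "K1 - G" K2])
  \<comment> \<open>\<open>G\<close> covers the part of \<open>K1\<close> that \<open>O1\<close>
    misses. As \<open>O1\<close> and \<open>O2\<close> are disjoint, a common point of
    \<open>W1\<close> and \<open>W2\<close> must lie in \<open>G\<close>.\<close>
  define W1 where "W1 = N1 \<inter> (O1 \<union> G)"
  define W2 where "W2 = N2 \<inter> O2"
  have sub: "N1 \<subseteq> X" "N2 \<subseteq> X"
    using N openin_imp_subset by blast+
  have op: "openin (top_of_set X) W1" "openin (top_of_set X) W2"
    unfolding W1_def W2_def using N O G by (auto intro: openin_Int_open)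
  have "finite_rank_inclusion TYPE('c) (int p) (top_of_set X) (W1 \<union> W2) N"
  proof (rule finite_rank_inclusion_Un [OF op])
    have "W1 \<inter> W2 \<subseteq> W12"
      using O(5) sub G(2) unfolding W1_def W2_def by blast
    then show "finite_rank_inclusion TYPE('c) (int p - 1) (top_of_set X) (W1 \<inter> W2) (N1 \<inter> N2)"
      using finite_rank_inclusion_mono [OF r12] by blast
  qed (use r1 r2 K in \<open>auto simp: W1_def W2_def\<close>)
  moreover have "openin (top_of_set X) (W1 \<union> W2)"
    using op by (rule openin_Un)
  moreover have "K1 \<union> K2 \<subseteq> W1 \<union> W2" "W1 \<union> W2 \<subseteq> N"
    using K O unfolding W1_def W2_def by blast+
  ultimately show thesis
    using that by blast
qed

text \<open>The shift by 1 starts the induction in degree -1, where all chains vanish.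
  \<open>K\<close> and \<open>N\<close> vary, since the induction hypothesis is applied to overlaps
  of pieces inside smaller open sets.\<close>

lemma finite_rank_open_neighbourhood_compact:
  fixes X :: "'a::euclidean_space set"
  assumes lc: "locally_contractible_space (top_of_set X)"
    and "compact K" "K \<subseteq> N" "openin (top_of_set X) N"
  shows "\<exists>W. openin (top_of_set X) W \<and> K \<subseteq> W \<and> W \<subseteq> N \<and>
    finite_rank_inclusion TYPE('c::idom) (int p - 1) (top_of_set X) W N"
  using assms(2-)
proof (induction p arbitrary: K N)
  case 0
  then show ?case
    using finite_rank_inclusion_negative [where 'c = 'c, of "int 0 - 1" "top_of_set X" N N] by auto
next
  case (Suc p)
  define good where "good L \<longleftrightarrow> (\<exists>W. openin (top_of_set X) W \<and> L \<subseteq> W \<and> W \<subseteq> N \<and>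
    finite_rank_inclusion TYPE('c) (int p) (top_of_set X) W N)" for L
  have "\<forall>x\<in>K. \<exists>W. openin (top_of_set X) W \<and> x \<in> W \<and> W \<subseteq> N \<and>
      finite_rank_inclusion TYPE('c) (int p) (top_of_set X) W N"
  proof
    fix x assume "x \<in> K"
    then have "x \<in> N"
      using Suc.prems(2) by blast
    from finite_rank_inclusion_locally [OF lc Suc.prems(3) this]
    show "\<exists>W. openin (top_of_set X) W \<and> x \<in> W \<and> W \<subseteq> N \<and>
      finite_rank_inclusion TYPE('c) (int p) (top_of_set X) W N"
      by metis
  qed
  from bchoice [OF this] obtain W where W: "\<And>x. x \<in> K \<Longrightarrow> openin (top_of_set X) (W x) \<and> x \<in> W x \<and> W x \<subseteq> N \<and>
      finite_rank_inclusion TYPE('c) (int p) (top_of_set X) (W x) N"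
    by blast
  \<comment> \<open>Open balls give the finite subcover, while closed balls cut compact pieces out
    of \<open>K\<close> that still lie in \<open>W x\<close>.\<close>
  have "\<exists>e>0. cball x e \<inter> X \<subseteq> W x" if "x \<in> K" for x
  proof -
    have "openin (top_of_set X) (W x)" "x \<in> W x"
      using W [OF that] by auto
    then show ?thesis
      unfolding openin_contains_cball by blast
  qed
  then obtain e where e: "\<And>x. x \<in> K \<Longrightarrow> e x > 0 \<and> cball x (e x) \<inter> X \<subseteq> W x"
    by metis
  obtain F where F: "F \<subseteq> K" "finite F" "K \<subseteq> (\<Union>x\<in>F. ball x (e x))"
    by (rule compactE_image [OF Suc.prems(1), of K "\<lambda>x. ball x (e x)"]) (use e in auto)
  have KX: "K \<subseteq> X"
    using Suc.prems openin_imp_subset by blast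
  have "good (\<Union>x\<in>F'. K \<inter> cball x (e x))" if "finite F'" "F' \<subseteq> K" for F'
    using that
  proof (induction F')
    case empty
    then show ?case
      using finite_rank_inclusion_empty unfolding good_def by (intro exI [of _ "{}"]) auto
  next
    case (insert x F')
    let ?L = "\<Union>x\<in>F'. K \<inter> cball x (e x)" and ?B = "K \<inter> cball x (e x)"
    obtain N2 where N2: "openin (top_of_set X) N2" "?L \<subseteq> N2" "N2 \<subseteq> N"
      "finite_rank_inclusion TYPE('c) (int p) (top_of_set X) N2 N"
      using insert unfolding good_def by auto
    have x: "x \<in> K"
      using insert by simp
    have N1: "?B \<subseteq> W x"
      using e [OF x] KX by blast
    have comp: "compact ?L" "compact ?B"
      using Suc.prems(1) insert(1) by (auto intro!: compact_UN compact_Int)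
    \<comment> \<open>No contraction is available for the overlap of the new piece with the earlier
      ones, but its rank is needed only one degree lower.\<close>
    have "\<exists>W'. openin (top_of_set X) W' \<and> ?B \<inter> ?L \<subseteq> W' \<and> W' \<subseteq> W x \<inter> N2 \<and>
       finite_rank_inclusion TYPE('c) (int p - 1) (top_of_set X) W' (W x \<inter> N2)"
    proof (rule Suc.IH)
      show "compact (?B \<inter> ?L)"
        by (rule compact_Int [OF comp(2,1)])
      show "?B \<inter> ?L \<subseteq> W x \<inter> N2"
        using N1 N2 by blast
      show "openin (top_of_set X) (W x \<inter> N2)"
        using W [OF x] N2 by (intro openin_Int) auto
    qed
    then obtain W' where W': "openin (top_of_set X) W'" "?B \<inter> ?L \<subseteq> W'" "W' \<subseteq> W x \<inter> N2"
       "finite_rank_inclusion TYPE('c) (int p - 1) (top_of_set X) W' (W x \<inter> N2)"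
      by blast
    have "W x \<union> N2 \<subseteq> N"
      using W [OF x] N2 by blast
    have "openin (top_of_set X) (W x)" "finite_rank_inclusion TYPE('c) (int p) (top_of_set X) (W x) N"
      using W [OF x] by auto
    from finite_rank_open_neighbourhood_Un [OF comp(2,1) N1 N2(2) \<open>W x \<union> N2 \<subseteq> N\<close> this(1) N2(1) this(2) N2(4) W']
    have "good (?B \<union> ?L)"
      unfolding good_def by metis
    then show ?case
      by simp
  qed
  from this [OF F(2,1)] have "good (\<Union>x\<in>F. K \<inter> cball x (e x))" .
  moreover have "K \<subseteq> (\<Union>x\<in>F. K \<inter> cball x (e x))"
    using F(3) subsetD [OF ball_subset_cball] by blast
  ultimately show ?case
    unfolding good_def of_nat_Suc by (metis add_diff_cancel_left' order_trans)
qed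

lemma finite_rank_inclusion_sublevel:
  fixes X :: "(real^'n) set" and f :: "real^'n \<Rightarrow> real^'k"
  assumes "compact X" and lc: "locally_contractible_space (top_of_set X)" and f: "continuous_on X f"
    and uv: "\<And>j. u $ j < v $ j"
  shows "finite_rank_inclusion TYPE('c::idom) q (top_of_set X) (sublevel_set X f u) (sublevel_set X f v)"
proof (cases "q < 0")
  case True
  then show ?thesis
    by (rule finite_rank_inclusion_negative)
next
  case False
  \<comment> \<open>Strictness of \<open>u $ j < v $ j\<close> is what places an open set between
    the two closed sublevel sets.\<close>
  define N where "N = {x \<in> X. \<forall>j. f x $ j < v $ j}"
  have eq: "sublevel_set X f u = X \<inter> (\<Inter>j. {x \<in> X. f x $ j \<le> u $ j})"
    by (auto simp: sublevel_set_def)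
  have cont: "continuous_on X (\<lambda>x. f x $ j)" for j
    using f by (intro continuous_intros)
  have "closed {x \<in> X. f x $ j \<le> u $ j}" for j
    using assms(1) cont by (intro continuous_on_closed_Collect_le) (auto simp: compact_imp_closed)
  then have "compact (sublevel_set X f u)"
    using compact_Int_closed [OF assms(1), of "\<Inter>j. {x \<in> X. f x $ j \<le> u $ j}"] unfolding eq by auto
  moreover have "sublevel_set X f u \<subseteq> N"
    using uv by (auto simp: sublevel_set_def N_def intro: le_less_trans)
  moreover have "openin (top_of_set X) N"
  proof -
    have "openin (top_of_set X) (X \<inter> (\<lambda>x. f x $ j) -` {..<v $ j})" for j
      using cont by (rule continuous_openin_preimage_gen) auto
    then have "openin (top_of_set X) (\<Inter>j. X \<inter> (\<lambda>x. f x $ j) -` {..<v $ j})"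
      by (intro openin_INT2) auto
    moreover have "(\<Inter>j. X \<inter> (\<lambda>x. f x $ j) -` {..<v $ j}) = N"
      by (auto simp: N_def)
    ultimately show ?thesis by simp
  qed
  \<comment> \<open>The parameter \<open>nat q + 1\<close> gives degree \<open>q\<close>, because
    the lemma speaks of degree \<open>p - 1\<close>.\<close>
  ultimately have "\<exists>W. openin (top_of_set X) W \<and> sublevel_set X f u \<subseteq> W \<and> W \<subseteq> N \<and>
      finite_rank_inclusion TYPE('c) (int (nat q + 1) - 1) (top_of_set X) W N"
    by (rule finite_rank_open_neighbourhood_compact [OF lc])
  then obtain W where W: "sublevel_set X f u \<subseteq> W"
    "finite_rank_inclusion TYPE('c) (int (nat q + 1) - 1) (top_of_set X) W N"
    by blast
  have "N \<subseteq> sublevel_set X f v"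
    by (auto simp: N_def sublevel_set_def intro: less_imp_le)
  then show ?thesis
    using finite_rank_inclusion_mono [OF W(2) W(1)] False by simp
qed

section \<open>The rank invariant with integer coefficients\<close>

text \<open>Over the integers the coefficient embedding is the identity, so the general rank bounds
  apply to the library's chains.\<close>

lemma coeff_boundary_int: "coeff_boundary p c = chain_boundary p (c :: 'a chain)"
proof -
  have embed: "coeff_embed c = c" for c :: "'b \<Rightarrow>\<^sub>0 int"
    by (rule poly_mapping_eqI) simp
  show ?thesis
    using coeff_ext_embed [of "chain_boundary p" c, where 'c = int]
    by (simp add: coeff_boundary_eq_coeff_ext embed chain_boundary_diff)
qed

lemma coeff_cycles_int: "(c :: 'a chain) \<in> coeff_cycles (int p) X \<longleftrightarrow> singular_relcycle p X {} c"
  by (simp add: coeff_cycles_nat coeff_chains_nat singular_cycle singular_chain_def coeff_boundary_int)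

lemma coeff_boundaries_int: "(c :: 'a chain) \<in> coeff_boundaries (int p) X \<longleftrightarrow> singular_relboundary p X {} c"
  unfolding coeff_boundaries_nat singular_boundary
  by (simp add: Bex_def coeff_chains_nat singular_chain_def coeff_boundary_int eq_commute [of c] del: of_nat_Suc)

lemma scale_chain_int: "scale_chain a c = frag_cmul a c"
  by (rule poly_mapping_eqI) simp

text \<open>Independence speaks of sets and the rank bounds of tuples. An independent set too large
  would contain \<open>N\<close> distinct elements, and their relation, extended by 0, would
  contradict independence.\<close>

lemma (in comm_group) abelian_group_rank_le:
  assumes dep: "\<And>z. z \<in> {..<N::nat} \<rightarrow> carrier G \<Longrightarrow>
    \<exists>a :: nat \<Rightarrow> int. (\<exists>i<N. a i \<noteq> 0) \<and> finprod G (\<lambda>i. z i [^] a i) {..<N} = \<one>"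
  shows "abelian_group_rank G \<le> enat N"
  unfolding abelian_group_rank_def
proof (rule SUP_least)
  fix S assume "S \<in> {S. independent_in_group G S}"
  then have S: "finite S" "S \<subseteq> carrier G"
    and indep: "\<And>c :: 'a \<Rightarrow> int. finprod G (\<lambda>x. x [^] c x) S = \<one> \<Longrightarrow> \<forall>x\<in>S. c x = 0"
    by (auto simp: independent_in_group_def)
  show "enat (card S) \<le> enat N"
  proof (rule ccontr)
    assume "\<not> enat (card S) \<le> enat N"
    then have "N \<le> card S" by simp
    then obtain T where T: "T \<subseteq> S" "card T = N" "finite T"
      by (rule obtain_subset_with_card_n)
    then obtain z where "bij_betw z {0..<N} T"
      using ex_bij_betw_nat_finite by blast
    then have z: "inj_on z {..<N}" "z ` {..<N} = T"
      by (auto simp: bij_betw_def atLeast0LessThan)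
    have zc: "z i \<in> carrier G" if "i < N" for i
      using that z S T by blast
    obtain a :: "nat \<Rightarrow> int" and k where a: "k < N" "a k \<noteq> 0" "finprod G (\<lambda>i. z i [^] a i) {..<N} = \<one>"
      using dep [of z] zc by auto
    define c where "c x = (if x \<in> T then a (the_inv_into {..<N} z x) else 0)" for x
    have cz: "c (z i) = a i" if "i < N" for i
    proof -
      have "z i \<in> T" "the_inv_into {..<N} z (z i) = i"
        using that z by (auto intro: the_inv_into_f_f)
      then show ?thesis
        by (simp add: c_def)
    qed
    have "finprod G (\<lambda>x. x [^] c x) S = finprod G (\<lambda>x. x [^] c x) (z ` {..<N})"
      unfolding z(2) using S T by (intro finprod_mono_neutral_cong_right) (auto simp: c_def)
    also have "\<dots> = finprod G (\<lambda>i. z i [^] c (z i)) {..<N}"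
      using zc by (intro finprod_reindex z) auto
    also have "\<dots> = finprod G (\<lambda>i. z i [^] a i) {..<N}"
      using zc cz by (intro finprod_cong') auto
    finally have "\<forall>x\<in>S. c x = 0"
      using a by (intro indep) simp
    moreover have "z k \<in> S"
      using a(1) z T by blast
    ultimately show False
      using a cz by metis
  qed
qed

text \<open>For negative degrees, where the induced map is constant. The bound 1 suffices for
  finiteness and avoids any appeal to group laws.\<close>

lemma abelian_group_rank_subset_singleton:
  assumes "carrier G \<subseteq> {x}"
  shows "abelian_group_rank G \<le> 1"
  unfolding abelian_group_rank_def
proof (rule SUP_least)
  fix S assume "S \<in> {S. independent_in_group G S}"
  then have "S \<subseteq> {x}"
    using assms by (auto simp: independent_in_group_def)
  then have "card S \<le> card {x}"
    by (intro card_mono) auto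
  then show "enat (card S) \<le> 1"
    by (simp add: one_enat_def)
qed

text \<open>The image consists of the classes in \<open>XB\<close> of cycles of \<open>XA\<close>.
  Taking classes is a homomorphism from the additive cycle group, so a relation among cycles modulo
  boundaries becomes a multiplicative relation in the image.\<close>

lemma abelian_group_rank_homology_image:
  assumes "A \<subseteq> B" and rank: "finite_rank_inclusion TYPE(int) q X A B"
  defines "XA \<equiv> subtopology X A" and "XB \<equiv> subtopology X B"
  shows "abelian_group_rank ((homology_group q XB)
     \<lparr>carrier := hom_induced q XA {} XB {} id ` carrier (homology_group q XA)\<rparr>) < \<infinity>"
proof (cases "q < 0")
  case True
  show ?thesis
    by (rule le_less_trans [OF abelian_group_rank_subset_singleton [of _ undefined]])
      (auto simp: hom_induced_trivial [OF True] one_enat_def)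
next
  case False
  then obtain p where p: "q = int p"
    by (metis nonneg_int_cases not_less)
  let ?H = "homology_group (int p) XB" and ?R = "relcycle_group p XA {}"
  let ?I = "hom_induced q XA {} XB {} id ` carrier (homology_group q XA)"
  let ?cls = "homologous_rel_set p XB {}"
  have mono: "singular_relcycle p XB {} c" if "singular_relcycle p XA {} c" for c
    using that \<open>A \<subseteq> B\<close> singular_cycle_mono unfolding XA_def XB_def by blast
  have cont: "continuous_map XA XB id"
    using \<open>A \<subseteq> B\<close> unfolding XA_def XB_def by (simp add: continuous_map_from_subtopology_mono continuous_map_in_subtopology subset_iff)
  have I: "?I = ?cls ` carrier ?R"
    unfolding p carrier_relative_homology_group image_image carrier_relcycle_group
  proof (rule image_cong)
    fix c assume "c \<in> singular_relcycle_set p XA {}"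
    then show "hom_induced (int p) XA {} XB {} id (homologous_rel_set p XA {} c) = ?cls c"
      using cont chain_map_ident [of p XA c] by (simp add: hom_induced_chain_map singular_cycle)
  qed simp
  have "r_coset (relcycle_group p XB {}) (singular_relboundary_set p XB {}) \<in> hom (relcycle_group p XB {}) ?H"
    unfolding nontrivial_relative_homology_group
    by (rule normal.r_coset_hom_Mod [OF normal_subgroup_singular_relboundary_relcycle])
  then have "?cls \<in> hom ?R ?H"
    unfolding right_coset_singular_relboundary using mono by (auto simp: hom_def)
  then interpret h: group_hom ?R ?H ?cls
    by (simp add: group_hom_def group_hom_axioms_def)
  define G where "G = ?H\<lparr>carrier := ?cls ` carrier ?R\<rparr>"
  have G_simps: "carrier G = ?cls ` carrier ?R" "\<one>\<^bsub>G\<^esub> = singular_relboundary_set p XB {}"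
    "(\<otimes>\<^bsub>G\<^esub>) = (\<otimes>\<^bsub>?H\<^esub>)"
    by (simp_all add: G_def)
  have sub: "subgroup (?cls ` carrier ?R) ?H"
    by (rule h.img_is_subgroup)
  have "comm_group G"
  proof (rule group.group_comm_groupI)
    show "group G"
      unfolding G_def using sub by (rule h.H.subgroup_imp_group)
    show "x \<otimes>\<^bsub>G\<^esub> y = y \<otimes>\<^bsub>G\<^esub> x" if "x \<in> carrier G" "y \<in> carrier G" for x y
      using that subgroup.subset [OF sub] comm_groupE(4) [OF abelian_relative_homology_group [of "int p" XB "{}"]]
      by (auto simp: G_simps)
  qed
  then interpret G: comm_group G .
  have "?cls \<in> hom ?R G"
    using h.homh by (auto simp: hom_def G_simps)
  then interpret g: group_hom ?R G ?cls
    by (intro group_hom.intro group_hom_axioms.intro G.group_axioms group_relcycle_group)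
  obtain N where N: "\<And>z. (\<forall>i<N. z i \<in> coeff_cycles q XA) \<Longrightarrow>
      (\<exists>a :: nat \<Rightarrow> int. (\<exists>i<N. a i \<noteq> 0) \<and> (\<Sum>i<N. scale_chain (a i) (z i)) \<in> coeff_boundaries q XB)"
    using rank unfolding finite_rank_inclusion_def finite_rank_mod_def XA_def XB_def by blast
  have "abelian_group_rank G \<le> enat N"
  proof (rule G.abelian_group_rank_le)
    fix z assume "z \<in> {..<N} \<rightarrow> carrier G"
    then have "\<forall>i\<in>{..<N}. \<exists>c. c \<in> carrier ?R \<and> z i = ?cls c"
      by (fastforce simp: G_simps)
    from bchoice [OF this] obtain r where r: "\<And>i. i < N \<Longrightarrow> r i \<in> carrier ?R \<and> z i = ?cls (r i)"
      by blast
    then have "\<forall>i<N. r i \<in> coeff_cycles q XA"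
      by (simp add: p coeff_cycles_int)
    from N [OF this] obtain a :: "nat \<Rightarrow> int" where a: "\<exists>i<N. a i \<noteq> 0"
      "(\<Sum>i<N. frag_cmul (a i) (r i)) \<in> coeff_boundaries q XB"
      by (auto simp: scale_chain_int)
    \<comment> \<open>Powers in the multiplicatively written cycle group are integer multiples of
      chains.\<close>
    have pow: "r i [^]\<^bsub>?R\<^esub> n = frag_cmul n (r i)" if "i < N" for i and n :: int
    proof -
      have "r i \<in> carrier (chain_group p XA)"
        using r [OF that] by (simp add: singular_cycle)
      then have "Poly_Mapping.keys (r i) \<subseteq> singular_simplex_set p XA"
        by (simp add: singular_chain_def)
      moreover have "r i [^]\<^bsub>?R\<^esub> n = r i [^]\<^bsub>chain_group p XA\<^esub> n"
        unfolding relcycle_group_def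
        by (rule group.int_pow_subgroup_generated) (use r [OF that] in \<open>simp_all flip: relcycle_group_def\<close>)
      ultimately show ?thesis
        by (simp add: chain_group_def)
    qed
    have "(\<Sum>i<n. frag_cmul (a i) (r i)) \<in> carrier ?R \<and>
       finprod G (\<lambda>i. z i [^]\<^bsub>G\<^esub> a i) {..<n} = ?cls (\<Sum>i<n. frag_cmul (a i) (r i))" if "n \<le> N" for n
      using that
    proof (induction n)
      case 0
      then show ?case
        using g.hom_one by simp
    next
      case (Suc n)
      have rn: "r n \<in> carrier ?R" "z n = ?cls (r n)"
        using r Suc.prems by auto
      have fn: "frag_cmul (a n) (r n) \<in> carrier ?R"
        using h.G.int_pow_closed [OF rn(1), of "a n"] pow [of n "a n"] Suc.prems by simp
      have zn: "z n [^]\<^bsub>G\<^esub> a n = ?cls (frag_cmul (a n) (r n))"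
        using g.hom_int_pow [OF rn(1), of "a n"] pow [of n "a n"] rn(2) Suc.prems by simp
      have zc: "(\<lambda>i. z i [^]\<^bsub>G\<^esub> a i) \<in> {..<Suc n} \<rightarrow> carrier G"
      proof
        fix i assume "i \<in> {..<Suc n}"
        then have "z i \<in> carrier G"
          using r [of i] Suc.prems by (auto simp: G_simps)
        then show "z i [^]\<^bsub>G\<^esub> a i \<in> carrier G"
          by (rule G.int_pow_closed)
      qed
      have IH: "(\<Sum>i<n. frag_cmul (a i) (r i)) \<in> carrier ?R"
        "finprod G (\<lambda>i. z i [^]\<^bsub>G\<^esub> a i) {..<n} = ?cls (\<Sum>i<n. frag_cmul (a i) (r i))"
        using Suc by auto
      have "finprod G (\<lambda>i. z i [^]\<^bsub>G\<^esub> a i) {..<Suc n} =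
          ?cls (frag_cmul (a n) (r n)) \<otimes>\<^bsub>G\<^esub> ?cls (\<Sum>i<n. frag_cmul (a i) (r i))"
        unfolding lessThan_Suc using zc zn IH(2) g.hom_closed [OF fn]
        by (subst G.finprod_insert) (auto simp: Pi_iff)
      also have "\<dots> = ?cls (frag_cmul (a n) (r n) + (\<Sum>i<n. frag_cmul (a i) (r i)))"
        using g.hom_mult [OF fn IH(1)] by simp
      finally show ?case
        using h.G.m_closed [OF fn IH(1)] by (simp add: add.commute)
    qed
    then have "finprod G (\<lambda>i. z i [^]\<^bsub>G\<^esub> a i) {..<N} = ?cls (\<Sum>i<N. frag_cmul (a i) (r i))"
      by blast
    also have "\<dots> = \<one>\<^bsub>G\<^esub>"
      using a(2) by (simp add: p coeff_boundaries_int G_simps homologous_rel_set_eq_relboundary)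
    finally show "\<exists>a :: nat \<Rightarrow> int. (\<exists>i<N. a i \<noteq> 0) \<and> finprod G (\<lambda>i. z i [^]\<^bsub>G\<^esub> a i) {..<N} = \<one>\<^bsub>G\<^esub>"
      using a(1) by blast
  qed
  then show ?thesis
    unfolding I unfolding p G_def using enat_ord_simps(4) le_less_trans by blast
qed

section \<open>The rank invariant with field coefficients\<close>

text \<open>For the least admissible bound \<open>Suc n\<close> some \<open>n\<close> elements are
  independent modulo \<open>B\<close>. Adding any \<open>x\<close> forces a relation, which can be
  solved for \<open>x\<close> by division.\<close>

lemma finite_rank_mod_spanning:
  fixes A B :: "('b \<Rightarrow>\<^sub>0 'c::field) set"
  assumes rank: "finite_rank_mod A B"
    and scale: "\<And>a x. x \<in> B \<Longrightarrow> scale_chain a x \<in> B"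
  obtains n :: nat and z where "\<And>i. i < n \<Longrightarrow> z i \<in> A"
    "\<And>x. x \<in> A \<Longrightarrow> \<exists>b. x - (\<Sum>i<n. scale_chain (b i) (z i)) \<in> B"
proof -
  define P where "P N \<longleftrightarrow> (\<forall>z. (\<forall>i<N. z i \<in> A) \<longrightarrow>
        (\<exists>a. (\<exists>i<N. a i \<noteq> 0) \<and> (\<Sum>i<N. scale_chain (a i) (z i)) \<in> B))" for N :: nat
  define N where "N = (LEAST N. P N)"
  have "\<exists>N. P N"
    using rank by (simp add: finite_rank_mod_def P_def)
  then have PN: "P N"
    unfolding N_def by (rule LeastI_ex)
  have "\<not> P 0"
    by (simp add: P_def)
  with PN obtain n where n: "N = Suc n"
    by (metis not0_implies_Suc)
  then have "\<not> P n"
    using not_less_Least [of n P] N_def by simp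
  then obtain z where z: "\<forall>i<n. z i \<in> A"
    and indep: "\<And>a. (\<Sum>i<n. scale_chain (a i) (z i)) \<in> B \<Longrightarrow> \<forall>i<n. a i = 0"
    unfolding P_def by blast
  have "\<exists>b. x - (\<Sum>i<n. scale_chain (b i) (z i)) \<in> B" if x: "x \<in> A" for x
  proof -
    have "\<forall>i<Suc n. (z(n := x)) i \<in> A"
      using z x by (auto simp: less_Suc_eq)
    then obtain a where a: "\<exists>i<Suc n. a i \<noteq> 0" "(\<Sum>i<Suc n. scale_chain (a i) ((z(n := x)) i)) \<in> B"
      using PN unfolding P_def n by blast
    have sum: "(\<Sum>i<n. scale_chain (a i) (z i)) + scale_chain (a n) x \<in> B"
      using a(2) by simp
    \<comment> \<open>Otherwise the relation would involve only the independent elements.\<close>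
    have "a n \<noteq> 0"
    proof
      assume "a n = 0"
      then have "\<forall>i<n. a i = 0"
        using sum by (intro indep) simp
      with \<open>a n = 0\<close> a(1) show False
        by (auto simp: less_Suc_eq)
    qed
    then have "scale_chain (inverse (a n)) ((\<Sum>i<n. scale_chain (a i) (z i)) + scale_chain (a n) x)
       = x - (\<Sum>i<n. scale_chain (- inverse (a n) * a i) (z i))"
      by (simp add: scale_chain_add scale_chain_sum scale_chain_minus_left sum_negf)
    with scale [OF sum, of "inverse (a n)"] show ?thesis
      by (metis (no_types))
  qed
  then show thesis
    using that z by blast
qed

text \<open>\<open>simplex_map\<close> restricts to the standard simplex; singular simplices are
  extensional, so they are unchanged.\<close>

lemma coeff_chain_map_id:
  assumes "c \<in> coeff_chains (int p) X"
  shows "coeff_chain_map p id c = c"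
proof -
  have "coeff_chain_map p id c = linear_extend (\<lambda>s. Poly_Mapping.single s 1) c"
    unfolding coeff_chain_map_def
    using assms by (intro linear_extend_cong) (auto simp: coeff_chains_nat singular_simplex_def extensional_restrict)
  then show ?thesis by simp
qed

section \<open>Homology with field coefficients as a vector space\<close>

lemma field_type_ring: "Ring.field (type_ring :: 'c::field ring)"
proof -
  have ab: "abelian_group (type_ring :: 'c ring)"
    by (rule abelian_groupI) (auto simp: type_ring_def algebra_simps intro: exI [of _ "- _"] left_minus)
  have "cring (type_ring :: 'c ring)"
    by (rule cringI [OF ab]) (auto simp: type_ring_def algebra_simps intro!: comm_monoidI)
  then show ?thesis
    by (rule cring.cring_fieldI2) (auto simp: type_ring_def intro: right_inverse)
qed

definition coeff_class :: "int \<Rightarrow> 'a topology \<Rightarrow> ('a, 'c::comm_ring_1) coeff_chain \<Rightarrow> ('a, 'c) coeff_chain set" where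
  "coeff_class q X c = {c + b | b. b \<in> coeff_boundaries q X}"

lemma coeff_class_eq_iff: "coeff_class q X c = coeff_class q X d \<longleftrightarrow> c - d \<in> coeff_boundaries q X"
proof
  assume "coeff_class q X c = coeff_class q X d"
  moreover have "c \<in> coeff_class q X c"
    using coeff_boundaries_linear(1) by (force simp: coeff_class_def)
  ultimately show "c - d \<in> coeff_boundaries q X"
    by (auto simp: coeff_class_def)
next
  assume cd: "c - d \<in> coeff_boundaries q X"
  then have dc: "d - c \<in> coeff_boundaries q X"
    using coeff_boundaries_linear(3) [of "c - d" q X "- 1"] by (simp add: scale_chain_minus_one)
  have sub: "coeff_class q X x \<subseteq> coeff_class q X y" if xy: "x - y \<in> coeff_boundaries q X" for x y
  proof
    fix w assume "w \<in> coeff_class q X x"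
    then obtain b where "b \<in> coeff_boundaries q X" "w = x + b"
      by (auto simp: coeff_class_def)
    then have "w = y + ((x - y) + b)" "(x - y) + b \<in> coeff_boundaries q X"
      using xy by (simp_all add: coeff_boundaries_linear)
    then show "w \<in> coeff_class q X y"
      unfolding coeff_class_def by blast
  qed
  show "coeff_class q X c = coeff_class q X d"
    using sub [OF cd] sub [OF dc] by blast
qed

lemma cycle_module_coset: "coeff_boundaries q X +>\<^bsub>cycle_module q X\<^esub> c = coeff_class q X c"
  by (auto simp: a_r_coset_def' cycle_module_def coeff_class_def add.commute)

lemma carrier_homology_module: "carrier (homology_module q X) = coeff_class q X ` coeff_cycles q X"
  by (auto simp: homology_module_def quotient_module_def A_RCOSETS_def' cycle_module_coset)
    (auto simp: cycle_module_def)

lemma zero_homology_module: "\<zero>\<^bsub>homology_module q X\<^esub> = coeff_class q X 0"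
  by (simp add: homology_module_def quotient_module_def coeff_class_def)

lemma add_homology_module:
  "coeff_class q X c \<oplus>\<^bsub>homology_module q X\<^esub> coeff_class q X d = coeff_class q X (c + d)"
proof -
  have "(\<Union>x\<in>coeff_class q X c. \<Union>y\<in>coeff_class q X d. {x + y}) = coeff_class q X (c + d)"
  proof (intro equalityI subsetI)
    fix w assume "w \<in> (\<Union>x\<in>coeff_class q X c. \<Union>y\<in>coeff_class q X d. {x + y})"
    then obtain b b' where "b \<in> coeff_boundaries q X" "b' \<in> coeff_boundaries q X" "w = (c + b) + (d + b')"
      by (auto simp: coeff_class_def)
    then have "w = c + d + (b + b')" "b + b' \<in> coeff_boundaries q X"
      by (simp_all add: coeff_boundaries_linear)
    then show "w \<in> coeff_class q X (c + d)"
      unfolding coeff_class_def by blast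
  next
    fix w assume "w \<in> coeff_class q X (c + d)"
    then obtain b where "b \<in> coeff_boundaries q X" "w = (c + b) + (d + 0)"
      by (auto simp: coeff_class_def)
    moreover have "0 \<in> coeff_boundaries q X"
      by (rule coeff_boundaries_linear)
    ultimately show "w \<in> (\<Union>x\<in>coeff_class q X c. \<Union>y\<in>coeff_class q X d. {x + y})"
      unfolding coeff_class_def by blast
  qed
  then show ?thesis
    by (simp add: homology_module_def quotient_module_def cycle_module_def set_add_def')
qed

text \<open>The union over representatives collapses to one class, since boundaries are closed under
  scaling.\<close>

lemma smult_homology_module:
  "a \<odot>\<^bsub>homology_module q X\<^esub> coeff_class q X c = coeff_class q X (scale_chain a c)"
proof -
  have "coeff_class q X (scale_chain a x) = coeff_class q X (scale_chain a c)" if "x \<in> coeff_class q X c" for x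
    unfolding coeff_class_eq_iff
    using that coeff_boundaries_linear(3) by (auto simp: coeff_class_def simp flip: scale_chain_diff)
  moreover have "c \<in> coeff_class q X c"
    using coeff_boundaries_linear(1) by (force simp: coeff_class_def)
  moreover have "a \<odot>\<^bsub>homology_module q X\<^esub> coeff_class q X c
      = (\<Union>x\<in>coeff_class q X c. coeff_class q X (scale_chain a x))"
    by (simp add: homology_module_def quotient_module_def cycle_module_coset) (simp add: cycle_module_def)
  ultimately show ?thesis
    by blast
qed

text \<open>An inclusion acts as the identity on cycles, and representatives that differ by a
  boundary of \<open>A\<close> have the same class in \<open>B\<close>.\<close>

lemma module_hom_induced_inclusion:
  assumes "A \<subseteq> B"
  shows "module_hom_induced q (subtopology X B) id ` carrier (homology_module q (subtopology X A))
       = coeff_class q (subtopology X B) ` (coeff_cycles q (subtopology X A) :: ('a, 'c::comm_ring_1) coeff_chain set)"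
  unfolding carrier_homology_module image_image
proof (rule image_cong)
  fix c :: "('a, 'c) coeff_chain"
  assume c: "c \<in> coeff_cycles q (subtopology X A)"
  have id: "coeff_chain_map (nat q) id x = x" if "x \<in> coeff_cycles q (subtopology X A)" for x :: "('a, 'c) coeff_chain"
  proof (cases "q < 0")
    case True
    with that show ?thesis
      by (simp add: coeff_cycles_def coeff_chains_def coeff_chain_map_def)
  next
    case False
    with that show ?thesis
      using coeff_chain_map_id [of x "nat q" "subtopology X A"] by (simp add: coeff_cycles_def)
  qed
  have "coeff_class q (subtopology X B) (coeff_chain_map (nat q) id x) = coeff_class q (subtopology X B) c"
    if "x \<in> coeff_class q (subtopology X A) c" for x
  proof -
    obtain b where b: "b \<in> coeff_boundaries q (subtopology X A)" "x = c + b"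
      using \<open>x \<in> _\<close> by (auto simp: coeff_class_def)
    then have "x \<in> coeff_cycles q (subtopology X A)"
      using c coeff_boundaries_subset_cycles by (auto intro: coeff_cycles_linear)
    moreover have "b \<in> coeff_boundaries q (subtopology X B)"
      using b(1) assms coeff_boundaries_mono by blast
    ultimately show ?thesis
      by (simp add: id coeff_class_eq_iff b(2))
  qed
  moreover have "c \<in> coeff_class q (subtopology X A) c"
    using coeff_boundaries_linear(1) by (force simp: coeff_class_def)
  ultimately show "module_hom_induced q (subtopology X B) id (coeff_class q (subtopology X A) c) = coeff_class q (subtopology X B) c"
    unfolding module_hom_induced_def cycle_module_coset by blast
qed simp

text \<open>\<open>Z\<close> is any set of chains closed under the linear operations; the intended
  case is the cycles of a subspace, whose classes form the image of its homology.\<close>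

lemma vectorspace_homology_image:
  fixes Z :: "('a, 'c::field) coeff_chain set"
  assumes zero: "0 \<in> Z" and add: "\<And>x y. x \<in> Z \<Longrightarrow> y \<in> Z \<Longrightarrow> x + y \<in> Z"
    and scale: "\<And>a x. x \<in> Z \<Longrightarrow> scale_chain a x \<in> Z"
  shows "vectorspace (type_ring :: 'c ring) ((homology_module q X)\<lparr>carrier := coeff_class q X ` Z\<rparr>)"
proof -
  interpret K: Ring.field "type_ring :: 'c ring"
    by (rule field_type_ring)
  let ?V = "(homology_module q X :: ('c, ('a, 'c) coeff_chain set) module)\<lparr>carrier := coeff_class q X ` Z\<rparr>"
  note simps = zero_homology_module add_homology_module smult_homology_module
  have "abelian_group ?V"
  proof (rule abelian_groupI)
    fix x assume "x \<in> carrier ?V"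
    then obtain c where c: "c \<in> Z" "x = coeff_class q X c"
      by auto
    then show "\<exists>y\<in>carrier ?V. y \<oplus>\<^bsub>?V\<^esub> x = \<zero>\<^bsub>?V\<^esub>"
      using scale [of c "- 1"] by (intro bexI [of _ "coeff_class q X (- c)"]) (auto simp: simps scale_chain_minus_one)
  qed (auto simp: simps zero add add_ac intro!: image_eqI)
  then have "Module.module type_ring ?V"
    by (rule moduleI [OF K.is_cring])
      (auto simp: simps type_ring_def scale scale_chain_add scale_chain_add_left intro!: image_eqI)
  then show ?thesis
    using K.field_axioms by (simp add: vectorspace_def)
qed

text \<open>Cycles that span modulo boundaries have classes that span the image, which makes it
  finite-dimensional.\<close>

lemma vectorspace_dimension_homology_image:
  assumes "A \<subseteq> B" and rank: "finite_rank_inclusion TYPE('c::field) q X A B"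
  defines "XA \<equiv> subtopology X A" and "XB \<equiv> subtopology X B"
  shows "vectorspace_dimension (type_ring :: 'c ring)
    ((homology_module q XB)\<lparr>carrier := module_hom_induced q XB id ` carrier (homology_module q XA)\<rparr>) < \<infinity>"
proof -
  let ?Z = "coeff_cycles q XA :: ('a, 'c) coeff_chain set"
  let ?V = "(homology_module q XB)\<lparr>carrier := coeff_class q XB ` ?Z\<rparr>"
  note simps = zero_homology_module add_homology_module smult_homology_module
  interpret V: vectorspace "type_ring :: 'c ring" ?V
    by (rule vectorspace_homology_image) (auto intro: coeff_cycles_linear)
  obtain n :: nat and z where z: "\<And>i. i < n \<Longrightarrow> z i \<in> ?Z"
    and span: "\<And>x. x \<in> ?Z \<Longrightarrow> \<exists>b. x - (\<Sum>i<n. scale_chain (b i) (z i)) \<in> coeff_boundaries q XB"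
    using rank unfolding finite_rank_inclusion_def XA_def XB_def
    by (rule finite_rank_mod_spanning) (auto intro: coeff_boundaries_linear)
  define S where "S = (\<lambda>i. coeff_class q XB (z i)) ` {..<n}"
  have S: "S \<subseteq> carrier ?V"
    using z by (auto simp: S_def)
  interpret span: submodule "type_ring :: 'c ring" "V.span S" ?V
    using S by (rule V.span_is_submodule)
  have "carrier ?V \<subseteq> V.span S"
  proof
    fix w assume "w \<in> carrier ?V"
    then obtain x where x: "x \<in> ?Z" "w = coeff_class q XB x"
      by auto
    obtain b where b: "x - (\<Sum>i<n. scale_chain (b i) (z i)) \<in> coeff_boundaries q XB"
      using span [OF x(1)] by blast
    have "coeff_class q XB (\<Sum>i<m. scale_chain (b i) (z i)) \<in> V.span S" if "m \<le> n" for m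
      using that
    proof (induction m)
      case 0
      then show ?case
        using span.zero_closed by (simp add: simps)
    next
      case (Suc m)
      have "coeff_class q XB (z m) \<in> V.span S"
        using V.in_own_span [OF S] Suc.prems by (auto simp: S_def)
      then have "b m \<odot>\<^bsub>?V\<^esub> coeff_class q XB (z m) \<in> V.span S"
        by (intro span.smult_closed) (simp add: type_ring_def)
      with Suc show ?case
        using span.m_closed by (simp add: simps flip: add_homology_module)
    qed
    then show "w \<in> V.span S"
      using b by (auto simp: x(2) simp flip: coeff_class_eq_iff)
  qed
  then have "V.span S = carrier ?V"
    using span.subset by blast
  then have "V.fin_dim"
    unfolding V.fin_dim_def using S by (intro exI [of _ S]) (simp add: S_def)
  moreover have "module_hom_induced q XB id ` carrier (homology_module q XA) = coeff_class q XB ` ?Z"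
    unfolding XA_def XB_def by (rule module_hom_induced_inclusion [OF \<open>A \<subseteq> B\<close>])
  ultimately show ?thesis
    by (simp add: vectorspace_dimension_def)
qed

theorem theorem1:
  fixes X :: "(real^'n) set" and f :: "real^'n \<Rightarrow> real^'k"
    and q :: int and u v :: "real^'k"
  assumes "compact X"
    and "locally_contractible_space (top_of_set X)"
    and "continuous_on X f"
    and "\<And>j. u $ j < v $ j"
  shows "rank_invariant_int X f q u v < \<infinity> \<and>
         rank_invariant_field TYPE('c::field) X f q u v < \<infinity>"
proof -
  have le: "u $ j \<le> v $ j" for j
    using assms(4) less_imp_le by blast
  have sub: "sublevel_set X f u \<subseteq> sublevel_set X f v"
    unfolding sublevel_set_def using le order_trans by blast
  \<comment> \<open>The rank bounds concern subtopologies of \<open>X\<close>, whereas the rank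
    invariants use sublevel sets as subspaces of the ambient space.\<close>
  have top: "top_of_set A = subtopology (top_of_set X) A" if "A \<subseteq> X" for A
    using that by (simp add: subtopology_subtopology Int_absorb1)
  have sublevel_top: "top_of_set (sublevel_set X f w) = subtopology (top_of_set X) (sublevel_set X f w)" for w
    by (rule top) (auto simp: sublevel_set_def)
  show ?thesis
    unfolding rank_invariant_int_def rank_invariant_field_def Let_def sublevel_top
    by (intro conjI abelian_group_rank_homology_image vectorspace_dimension_homology_image sub
        finite_rank_inclusion_sublevel assms)
qed

end
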